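(* Consider, for a Tverberg type $\mathcal I$ with parameters $d,r$ (a partition of $\{1,\dots,T(d,r)\}$ into $r$ parts, $T(d,r)=(r-1)(d+1)+1$), the assertion $(\ast)$ if $\mathcal I$ is colorful, then $\mathrm{Tv}_{\mathcal I}$ is unavoidable; if $\mathcal I$ is not colorful, then $\neg\mathrm{Tv}_{\mathcal I}$ is unavoidable. Then $(\ast)$ holds in each of the following cases: (1) $d\le 2$, all $r$, and all Tverberg types $\mathcal I$; (2) $d=3$, all $r$, and all Tverberg types $\mathcal I$ whose parts have sizes $2,3,4,4,\dots,4$ (one part of size $2$, one of size $3$, and all the others of size $4$); (3) $d=r=3$ and $\mathcal I$ any of the four colorful Tverberg types all of whose parts have size $3$; (4) $d=4$, all $r$, and $\mathcal I$ the zigzag type.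
   Context: Predicates. A $k$-ary (geometric) predicate on $\mathbb R^d$ is a property $\Phi$ of $k$-tuples $(p_1,\dots,p_k)\in(\mathbb R^d)^k$. All predicates considered are semialgebraic: $\Phi$ is given by a (fixed) Boolean combination of terms $f(p_1,\dots,p_k)>0$ with $f$ nonzero polynomials (the value of $\Phi$ on tuples at which some of these polynomials vanishes is irrelevant). A finite sequence of points $P$ in $\mathbb R^d$ is $\Phi$-generic if none of these polynomials vanishes on any $k$-tuple of distinct points of $P$. $\Phi$ occurs in $P=(p_1,\dots,p_n)$ if there are indices $i_1<\dots<i_k$ such that $\Phi(p_{i_1},\dots,p_{i_k})$ holds. $\Phi$ is unavoidable if there is $N$ such that $\Phi$ occurs in every $\Phi$-generic sequence of at least $N$ points. Tverberg types. $T(d,r)=(r-1)(d+1)+1$ for positive integers $d,r$. A Tverberg type is a partition $\mathcal I=\{I_1,\dots,I_r\}$ of $\{1,\dots,T(d,r)\}$ into $r$ (nonempty) parts. $\mathrm{Tv}_{\mathcal I}$ is the $T(d,r)$-ary predicate on $\mathbb R^d$ that holds for $(p_1,\dots,p_{T(d,r)})$ iff the $r$ convex hulls $\mathrm{conv}\{p_i : i\in I_j\}$, $1\le j\le r$, have a common point. $\mathcal I$ is colorful if for each $1\le i\le d+1$ the $r$ consecutive integers $(r-1)(i-1)+1,\dots,(r-1)i+1$ belong one to each of the $r$ parts. A Tverberg type is encoded by a string $\sigma\in\{1,\dots,r\}^{T(d,r)}$ where $\sigma(i)=j$ means $i\in I_j$. The zigzag type is the (colorful) type encoded by the string of length $T(d,r)$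 that walks back and forth, $1\,2\cdots r\cdots 2\,1\,2\cdots r\cdots$; e.g. for $r=3$, $d=4$ it is $12321232123$. *)

theory Defs
  imports
    "HOL-Analysis.Analysis"
    "HOL-Library.Disjoint_Sets"
    "HOL-Library.Multiset"
    "HOL-Library.Poly_Mapping"
begin

section \<open>Semialgebraic predicates on point tuples\<close>

text \<open>
  A sequence of \<open>n\<close> points of \<open>\<real>\<^sup>d\<close> is a function \<^typ>\<open>nat \<Rightarrow> real ^ 'd\<close> of which only the values at
  \<open>1, \<dots>, n\<close> matter, where \<open>d = CARD('d)\<close>; likewise for \<open>k\<close>-tuples.
  The variable \<open>(i, c)\<close> of a polynomial stands for the \<open>c\<close>-th coordinate of the \<open>i\<close>-th point, and a
  polynomial is a finitely supported map from monomials (exponent vectors) to coefficients.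
\<close>

type_synonym 'd point_poly = "((nat \<times> 'd) \<Rightarrow>\<^sub>0 nat) \<Rightarrow>\<^sub>0 real"

definition poly_vars :: "'d point_poly \<Rightarrow> (nat \<times> 'd) set" where
  "poly_vars f = (\<Union>m \<in> Poly_Mapping.keys f. Poly_Mapping.keys m)"

definition poly_value :: "'d::finite point_poly \<Rightarrow> (nat \<Rightarrow> real ^ 'd) \<Rightarrow> real" where
  "poly_value f p =
     (\<Sum>m \<in> Poly_Mapping.keys f. Poly_Mapping.lookup f m *
        (\<Prod>v \<in> Poly_Mapping.keys m. (p (fst v) $ snd v) ^ Poly_Mapping.lookup m v))"

datatype 'd bool_comb =
    Pos "'d point_poly"
  | Neg "'d bool_comb"
  | Conj "'d bool_comb" "'d bool_comb"
  | Disj "'d bool_comb" "'d bool_comb"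

primrec polys :: "'d bool_comb \<Rightarrow> 'd point_poly set" where
  "polys (Pos f) = {f}"
| "polys (Neg F) = polys F"
| "polys (Conj F G) = polys F \<union> polys G"
| "polys (Disj F G) = polys F \<union> polys G"

primrec holds :: "'d::finite bool_comb \<Rightarrow> (nat \<Rightarrow> real ^ 'd) \<Rightarrow> bool" where
  "holds (Pos f) p \<longleftrightarrow> poly_value f p > 0"
| "holds (Neg F) p \<longleftrightarrow> \<not> holds F p"
| "holds (Conj F G) p \<longleftrightarrow> holds F p \<and> holds G p"
| "holds (Disj F G) p \<longleftrightarrow> holds F p \<or> holds G p"

text \<open>
  \<open>F\<close> describes the \<open>k\<close>-ary predicate \<open>\<Phi>\<close>; the value of \<open>\<Phi>\<close> is irrelevant at tuples where one of
  the polynomials vanishes.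
\<close>

definition describes :: "nat \<Rightarrow> 'd::finite bool_comb \<Rightarrow> ((nat \<Rightarrow> real ^ 'd) \<Rightarrow> bool) \<Rightarrow> bool" where
  "describes k F \<Phi> \<longleftrightarrow>
     (\<forall>f \<in> polys F. f \<noteq> 0 \<and> poly_vars f \<subseteq> {1..k} \<times> UNIV) \<and>
     (\<forall>p. (\<forall>f \<in> polys F. poly_value f p \<noteq> 0) \<longrightarrow> (\<Phi> p \<longleftrightarrow> holds F p))"

definition semialgebraic :: "nat \<Rightarrow> ((nat \<Rightarrow> real ^ 'd::finite) \<Rightarrow> bool) \<Rightarrow> bool" where
  "semialgebraic k \<Phi> \<longleftrightarrow> (\<exists>F. describes k F \<Phi>)"

text \<open>
  The points of a tuple are distinct as members of the sequence, that is, they have distinct indices.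
\<close>

definition generic :: "nat \<Rightarrow> 'd::finite bool_comb \<Rightarrow> nat \<Rightarrow> (nat \<Rightarrow> real ^ 'd) \<Rightarrow> bool" where
  "generic k F n p \<longleftrightarrow>
     (\<forall>f \<in> polys F. \<forall>i. inj_on i {1..k} \<and> i ` {1..k} \<subseteq> {1..n} \<longrightarrow> poly_value f (p \<circ> i) \<noteq> 0)"

definition occurs :: "nat \<Rightarrow> ((nat \<Rightarrow> real ^ 'd::finite) \<Rightarrow> bool) \<Rightarrow> nat \<Rightarrow> (nat \<Rightarrow> real ^ 'd) \<Rightarrow> bool" where
  "occurs k \<Phi> n p \<longleftrightarrow>
     (\<exists>i. strict_mono_on {1..k} i \<and> i ` {1..k} \<subseteq> {1..n} \<and> \<Phi> (p \<circ> i))"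

text \<open>
  Genericity refers to the polynomials of a fixed description of \<open>\<Phi>\<close>, but whether \<open>\<Phi>\<close> is unavoidable
  does not depend on the description: a sequence generic for one description can be perturbed, without
  changing the sign of any of its polynomials, to one that is generic for another description as well.
  We require that a description exists and that the condition holds for every description.
\<close>

definition unavoidable :: "nat \<Rightarrow> ((nat \<Rightarrow> real ^ 'd::finite) \<Rightarrow> bool) \<Rightarrow> bool" where
  "unavoidable k \<Phi> \<longleftrightarrow>
     semialgebraic k \<Phi> \<and>
     (\<forall>F. describes k F \<Phi> \<longrightarrow> (\<exists>N. \<forall>n \<ge> N. \<forall>p. generic k F n p \<longrightarrow> occurs k \<Phi> n p))"

section \<open>Tverberg types\<close>

definition tverberg_number :: "nat \<Rightarrow> nat \<Rightarrow> nat" where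
  "tverberg_number d r = (r - 1) * (d + 1) + 1"

definition tverberg_type :: "nat \<Rightarrow> nat \<Rightarrow> nat set set \<Rightarrow> bool" where
  "tverberg_type d r \<I> \<longleftrightarrow> partition_on {1..tverberg_number d r} \<I> \<and> card \<I> = r"

definition Tv :: "nat set set \<Rightarrow> (nat \<Rightarrow> real ^ 'd::finite) \<Rightarrow> bool" where
  "Tv \<I> p \<longleftrightarrow> (\<exists>x. \<forall>J \<in> \<I>. x \<in> convex hull (p ` J))"

definition colorful :: "nat \<Rightarrow> nat \<Rightarrow> nat set set \<Rightarrow> bool" where
  "colorful d r \<I> \<longleftrightarrow>
     (\<forall>i \<in> {1..d + 1}. \<forall>J \<in> \<I>. \<exists>!x. x \<in> {(r - 1) * (i - 1) + 1..(r - 1) * i + 1} \<and> x \<in> J)"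

definition encoded_type :: "nat \<Rightarrow> nat \<Rightarrow> (nat \<Rightarrow> nat) \<Rightarrow> nat set set" where
  "encoded_type d r \<sigma> = (\<lambda>j. {i \<in> {1..tverberg_number d r}. \<sigma> i = j}) ` {1..r}"

text \<open>
  The walk \<open>1, 2, \<dots>, r, \<dots>, 2, 1, 2, \<dots>\<close> has period \<open>2 (r - 1)\<close>. For \<open>r = 1\<close> only the value at \<open>i = 1\<close>
  is used.
\<close>

definition zigzag_string :: "nat \<Rightarrow> nat \<Rightarrow> nat" where
  "zigzag_string r i =
     (let m = (i - 1) mod (2 * (r - 1)) in if m < r then m + 1 else 2 * r - 1 - m)"

lemma "map (zigzag_string 3) [1..<tverberg_number 4 3 + 1] = [1, 2, 3, 2, 1, 2, 3, 2, 1, 2, 3]"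
  by (simp add: zigzag_string_def tverberg_number_def upt_rec)

definition zigzag_type :: "nat \<Rightarrow> nat \<Rightarrow> nat set set" where
  "zigzag_type d r = encoded_type d r (zigzag_string r)"

text \<open>The assertion \<open>(\<ast>)\<close> for \<open>\<I>\<close>, in dimension \<open>d = CARD('d)\<close>.\<close>

definition unavoidability_dichotomy :: "'d::finite itself \<Rightarrow> nat \<Rightarrow> nat set set \<Rightarrow> bool" where
  "unavoidability_dichotomy (_ :: 'd itself) r \<I> \<longleftrightarrow>
     (colorful CARD('d) r \<I> \<longrightarrow>
        unavoidable (tverberg_number CARD('d) r) (\<lambda>p :: nat \<Rightarrow> real ^ 'd. Tv \<I> p)) \<and>
     (\<not> colorful CARD('d) r \<I> \<longrightarrow>
        unavoidable (tverberg_number CARD('d) r) (\<lambda>p :: nat \<Rightarrow> real ^ 'd. \<not> Tv \<I> p))"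

end

theory Submission
  imports Defs "HOL-Library.Ramsey"
begin

text \<open>
  The assertion holds for all dimensions \<open>d\<close> and all types (this is due to Por); the cases of the
  theorem are instances. Put \<open>D = d + 1\<close> and identify a point \<open>p\<close> with the vector \<open>(p, 1)\<close> of
  \<open>\<real>\<^sup>D\<close>.

  In a sequence that is homogeneous in the sense of Ramsey's theorem, let \<open>f\<^sub>k\<close> be the linear form,
  unique up to a factor, that vanishes on the first \<open>k - 1\<close> and on the last \<open>D - k\<close> vectors. On the
  vectors in the middle the \<open>f\<^sub>k\<close> have constant signs, and the ratios \<open>f\<^sub>k\<^sub>+\<^sub>1 / f\<^sub>k\<close> grow by an
  arbitrarily large factor from each vector to the next. The reason is that the growth factor is a
  cross ratio, and no long increasing sequence of reals has only bounded cross ratios. So in the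
  coordinates \<open>f\<^sub>1, \<dots>, f\<^sub>D\<close> the sequence is stretched.

  For a stretched sequence of \<open>(r - 1) D + 1\<close> vectors the Tverberg partitions are exactly the colorful
  ones. If the parts have a common point, then in each part and for each coordinate of the point one
  vector dominates, and the dominating vectors of consecutive coordinates occupy consecutive blocks
  of indices, which share at most one index; hence they fill the blocks of the definition of colorful.
  If the parts have no common point, then there are linear forms, one for each part, that sum
  to \<open>0\<close> and are positive on their parts, and comparing their coefficients coordinate by coordinate
  excludes this for a colorful partition.
\<close>

section \<open>Convex hulls of finite indexed families\<close>

text \<open>The set of such combinations is convex and contains every \<open>f j\<close>, hence the
  hull. Weights belong to indices, so \<open>f\<close> may take a value twice, as a point sequence
  may.\<close>

lemma convex_hull_image_finite:
  fixes f :: "'i \<Rightarrow> 'a::real_vector"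
  assumes "finite J"
  shows "x \<in> convex hull (f ` J) \<longleftrightarrow>
    (\<exists>u. (\<forall>i\<in>J. 0 \<le> u i) \<and> sum u J = 1 \<and> (\<Sum>i\<in>J. u i *\<^sub>R f i) = x)"
proof
  let ?S = "{x. \<exists>u. (\<forall>i\<in>J. 0 \<le> u i) \<and> sum u J = 1 \<and> (\<Sum>i\<in>J. u i *\<^sub>R f i) = x}"
  assume x: "x \<in> convex hull (f ` J)"
  have "f ` J \<subseteq> ?S"
  proof clarify
    fix j assume j: "j \<in> J"
    have "(\<Sum>i\<in>J. (if i = j then 1 else 0) *\<^sub>R f i) = (\<Sum>i\<in>J. if i = j then f i else 0)"
      by (rule sum.cong) auto
    with j assms show "\<exists>u. (\<forall>i\<in>J. 0 \<le> u i) \<and> sum u J = 1 \<and> (\<Sum>i\<in>J. u i *\<^sub>R f i) = f j"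
      by (intro exI[of _ "\<lambda>i. if i = j then 1 else 0"]) auto
  qed
  moreover have "convex ?S"
  proof (rule convexI, clarify)
    fix u v :: "'i \<Rightarrow> real" and s t :: real
    assume *: "\<forall>i\<in>J. 0 \<le> u i" "\<forall>i\<in>J. 0 \<le> v i" "sum u J = 1" "sum v J = 1"
      "0 \<le> s" "0 \<le> t" "s + t = 1"
    show "\<exists>w. (\<forall>i\<in>J. 0 \<le> w i) \<and> sum w J = 1 \<and>
        (\<Sum>i\<in>J. w i *\<^sub>R f i) = s *\<^sub>R (\<Sum>i\<in>J. u i *\<^sub>R f i) + t *\<^sub>R (\<Sum>i\<in>J. v i *\<^sub>R f i)"
      by (rule exI[of _ "\<lambda>i. s * u i + t * v i"])
        (use * in \<open>auto simp: sum.distrib scaleR_sum_right scaleR_add_left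
          simp flip: sum_distrib_left\<close>)
  qed
  ultimately have "convex hull (f ` J) \<subseteq> ?S"
    by (rule hull_minimal)
  with x show "\<exists>u. (\<forall>i\<in>J. 0 \<le> u i) \<and> sum u J = 1 \<and> (\<Sum>i\<in>J. u i *\<^sub>R f i) = x"
    by blast
next
  assume "\<exists>u. (\<forall>i\<in>J. 0 \<le> u i) \<and> sum u J = 1 \<and> (\<Sum>i\<in>J. u i *\<^sub>R f i) = x"
  then obtain u where "\<forall>i\<in>J. 0 \<le> u i" "sum u J = 1" "(\<Sum>i\<in>J. u i *\<^sub>R f i) = x"
    by blast
  with assms show "x \<in> convex hull (f ` J)"
    using convex_sum[OF assms convex_convex_hull, of u f "f ` J"] by (simp add: hull_inc)
qed

section \<open>Polynomial functions\<close>

definition monom_value :: "((nat \<times> 'd) \<Rightarrow>\<^sub>0 nat) \<Rightarrow> (nat \<Rightarrow> real ^ 'd::finite) \<Rightarrow> real" where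
  "monom_value m p = (\<Prod>v\<in>Poly_Mapping.keys m. (p (fst v) $ snd v) ^ Poly_Mapping.lookup m v)"

lemma monom_value_superset:
  assumes "finite V" "Poly_Mapping.keys m \<subseteq> V"
  shows "monom_value m p = (\<Prod>v\<in>V. (p (fst v) $ snd v) ^ Poly_Mapping.lookup m v)"
  unfolding monom_value_def
  by (rule prod.mono_neutral_left) (use assms in \<open>auto simp: in_keys_iff\<close>)

lemma monom_value_add: "monom_value (m + n) p = monom_value m p * monom_value n p"
proof -
  let ?V = "Poly_Mapping.keys m \<union> Poly_Mapping.keys n"
  have "Poly_Mapping.keys (m + n) \<subseteq> ?V"
    by (rule keys_add)
  then show ?thesis
    by (simp add: monom_value_superset[of ?V] lookup_add power_add prod.distrib)
qed

lemma monom_value_zero [simp]: "monom_value 0 p = 1"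
  by (simp add: monom_value_def)

text \<open>Lets two polynomials be summed over one index set: by cancellation the keys of a sum can
  be fewer than the union of the keys.\<close>

lemma poly_value_superset:
  assumes "finite M" "Poly_Mapping.keys f \<subseteq> M"
  shows "poly_value f p = (\<Sum>m\<in>M. Poly_Mapping.lookup f m * monom_value m p)"
  unfolding poly_value_def monom_value_def
  by (rule sum.mono_neutral_left) (use assms in \<open>auto simp: in_keys_iff\<close>)

lemma poly_value_add: "poly_value (f + g) p = poly_value f p + poly_value g p"
proof -
  let ?M = "Poly_Mapping.keys f \<union> Poly_Mapping.keys g"
  have "Poly_Mapping.keys (f + g) \<subseteq> ?M"
    by (rule keys_add)
  then show ?thesis
    by (simp add: poly_value_superset[of ?M] lookup_add distrib_right sum.distrib)
qed

lemma poly_value_zero [simp]: "poly_value 0 p = 0"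
  by (simp add: poly_value_def)

lemma poly_value_sum: "poly_value (\<Sum>i\<in>A. f i) p = (\<Sum>i\<in>A. poly_value (f i) p)"
  by (induction A rule: infinite_finite_induct) (simp_all add: poly_value_add)

lemma poly_value_single: "poly_value (Poly_Mapping.single m c) p = c * monom_value m p"
  by (simp add: poly_value_superset[of "{m}"])

lemma sum_single_lookup:
  "f = (\<Sum>m\<in>Poly_Mapping.keys f. Poly_Mapping.single m (Poly_Mapping.lookup f m))"
  by (rule poly_mapping_eqI) (simp add: lookup_sum lookup_single when_def in_keys_iff)

lemma poly_value_mult: "poly_value (f * g) p = poly_value f p * poly_value g p"
proof -
  let ?c = Poly_Mapping.lookup and ?K = Poly_Mapping.keys
  have "f * g = (\<Sum>m\<in>?K f. Poly_Mapping.single m (?c f m)) * (\<Sum>n\<in>?K g. Poly_Mapping.single n (?c g n))"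
    using sum_single_lookup[of f] sum_single_lookup[of g] by simp
  also have "\<dots> = (\<Sum>m\<in>?K f. \<Sum>n\<in>?K g. Poly_Mapping.single (m + n) (?c f m * ?c g n))"
    by (simp add: sum_product mult_single)
  finally have "poly_value (f * g) p =
      (\<Sum>m\<in>?K f. \<Sum>n\<in>?K g. (?c f m * monom_value m p) * (?c g n * monom_value n p))"
    by (simp add: poly_value_sum poly_value_single monom_value_add mult_ac)
  then show ?thesis
    by (simp add: sum_product poly_value_superset[of "?K f"] poly_value_superset[of "?K g"])
qed

definition polyfun :: "nat \<Rightarrow> ((nat \<Rightarrow> real ^ 'd::finite) \<Rightarrow> real) \<Rightarrow> bool" where
  "polyfun k \<phi> \<longleftrightarrow> (\<exists>f. poly_vars f \<subseteq> {1..k} \<times> UNIV \<and> \<phi> = poly_value f)"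

lemma polyfun_const: "polyfun k (\<lambda>p. c)"
  unfolding polyfun_def
  by (rule exI[of _ "Poly_Mapping.single 0 c"]) (simp add: poly_vars_def fun_eq_iff poly_value_single)

lemma polyfun_coord:
  assumes "i \<in> {1..k}"
  shows "polyfun k (\<lambda>p. p i $ c)"
  unfolding polyfun_def
  by (rule exI[of _ "Poly_Mapping.single (Poly_Mapping.single (i, c) 1) 1"])
    (use assms in \<open>simp add: poly_vars_def fun_eq_iff poly_value_single monom_value_def\<close>)

lemma polyfun_add:
  assumes "polyfun k \<phi>" "polyfun k \<psi>"
  shows "polyfun k (\<lambda>p. \<phi> p + \<psi> p)"
proof -
  obtain f g where "poly_vars f \<subseteq> {1..k} \<times> UNIV" "\<phi> = poly_value f"
    "poly_vars g \<subseteq> {1..k} \<times> UNIV" "\<psi> = poly_value g"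
    using assms unfolding polyfun_def by blast
  with keys_add[of f g] show ?thesis
    unfolding polyfun_def
    by (intro exI[of _ "f + g"]) (fastforce simp: poly_vars_def poly_value_add)
qed

lemma polyfun_mult:
  assumes "polyfun k \<phi>" "polyfun k \<psi>"
  shows "polyfun k (\<lambda>p. \<phi> p * \<psi> p)"
proof -
  obtain f g where fg: "poly_vars f \<subseteq> {1..k} \<times> UNIV" "\<phi> = poly_value f"
    "poly_vars g \<subseteq> {1..k} \<times> UNIV" "\<psi> = poly_value g"
    using assms unfolding polyfun_def by blast
  have "poly_vars (f * g) \<subseteq> poly_vars f \<union> poly_vars g"
  proof
    fix v assume "v \<in> poly_vars (f * g)"
    then obtain m n where "m \<in> Poly_Mapping.keys f" "n \<in> Poly_Mapping.keys g"
        "v \<in> Poly_Mapping.keys (m + n)"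
      using keys_mult[of f g] unfolding poly_vars_def by blast
    then show "v \<in> poly_vars f \<union> poly_vars g"
      using keys_add[of m n] unfolding poly_vars_def by blast
  qed
  with fg show ?thesis
    unfolding polyfun_def
    by (intro exI[of _ "f * g"]) (auto simp: poly_value_mult)
qed

lemma polyfun_diff:
  assumes "polyfun k \<phi>" "polyfun k \<psi>"
  shows "polyfun k (\<lambda>p. \<phi> p - \<psi> p)"
  using polyfun_add[OF assms(1) polyfun_mult[OF polyfun_const[of k "-1"] assms(2)]] by simp

lemma polyfun_uminus:
  assumes "polyfun k \<phi>"
  shows "polyfun k (\<lambda>p. - \<phi> p)"
  using polyfun_diff[OF polyfun_const[of k 0] assms] by simp

lemma continuous_on_poly_value: "continuous_on UNIV (poly_value f)"
  unfolding poly_value_def[abs_def]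
  by (intro continuous_intros continuous_on_product_coordinates)

section \<open>Closure properties of semialgebraic predicates\<close>

lemma describes_Neg: "describes k F \<Phi> \<Longrightarrow> describes k (Neg F) (\<lambda>p. \<not> \<Phi> p)"
  by (simp add: describes_def)

lemma semialgebraic_not: "semialgebraic k \<Phi> \<Longrightarrow> semialgebraic k (\<lambda>p. \<not> \<Phi> p)"
  using describes_Neg unfolding semialgebraic_def by blast

lemma semialgebraic_conj:
  assumes "semialgebraic k \<Phi>" "semialgebraic k \<Psi>"
  shows "semialgebraic k (\<lambda>p. \<Phi> p \<and> \<Psi> p)"
proof -
  obtain F G where "describes k F \<Phi>" "describes k G \<Psi>"
    using assms unfolding semialgebraic_def by blast
  then have "describes k (Conj F G) (\<lambda>p. \<Phi> p \<and> \<Psi> p)"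
    unfolding describes_def polys.simps holds.simps by blast
  then show ?thesis
    unfolding semialgebraic_def by blast
qed

lemma semialgebraic_imp:
  assumes "semialgebraic k \<Phi>" "semialgebraic k \<Psi>"
  shows "semialgebraic k (\<lambda>p. \<Phi> p \<longrightarrow> \<Psi> p)"
  using semialgebraic_not[OF semialgebraic_conj[OF assms(1) semialgebraic_not[OF assms(2)]]]
  by simp

lemma semialgebraic_const: "semialgebraic k (\<lambda>p :: nat \<Rightarrow> real ^ 'd::finite. b)"
proof -
  have "describes k (Pos 1) (\<lambda>p :: nat \<Rightarrow> real ^ 'd. True)"
    by (simp add: describes_def poly_vars_def poly_value_superset[of "{0}"])
  from this describes_Neg[OF this] show ?thesis
    unfolding semialgebraic_def by (cases b) auto
qed

lemma semialgebraic_pos: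
  assumes "polyfun k \<phi>"
  shows "semialgebraic k (\<lambda>p. \<phi> p > 0)"
proof -
  obtain f where f: "poly_vars f \<subseteq> {1..k} \<times> UNIV" "\<phi> = poly_value f"
    using assms unfolding polyfun_def by blast
  show ?thesis
  \<comment> \<open>\<open>describes\<close> does not admit the zero polynomial; in that case the
    predicate is constantly \<open>False\<close>.\<close>
  proof (cases "f = 0")
    case True
    then show ?thesis
      using f semialgebraic_const by simp
  next
    case False
    then have "describes k (Pos f) (\<lambda>p. \<phi> p > 0)"
      using f by (simp add: describes_def)
    then show ?thesis
      unfolding semialgebraic_def by blast
  qed
qed

lemma semialgebraic_neg:
  assumes "polyfun k \<phi>"
  shows "semialgebraic k (\<lambda>p. \<phi> p < 0)"
  using semialgebraic_pos[OF polyfun_diff[OF polyfun_const[of k 0] assms]] by simp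

lemma semialgebraic_nonneg:
  assumes "polyfun k \<phi>"
  shows "semialgebraic k (\<lambda>p. 0 \<le> \<phi> p)"
  using semialgebraic_not[OF semialgebraic_neg[OF assms]] by (simp add: not_less)

lemma semialgebraic_eq_0:
  assumes "polyfun k \<phi>"
  shows "semialgebraic k (\<lambda>p. \<phi> p = 0)"
proof -
  have "(\<lambda>p. \<phi> p = 0) = (\<lambda>p. \<not> \<phi> p > 0 \<and> \<not> \<phi> p < 0)"
    by auto
  then show ?thesis
    using semialgebraic_conj[OF semialgebraic_not[OF semialgebraic_pos[OF assms]]
        semialgebraic_not[OF semialgebraic_neg[OF assms]]] by simp
qed

lemma semialgebraic_Ball:
  assumes "finite C" "\<And>c. c \<in> C \<Longrightarrow> semialgebraic k (\<Phi> c)"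
  shows "semialgebraic k (\<lambda>p. \<forall>c\<in>C. \<Phi> c p)"
  using assms
  by (induction C) (simp_all add: semialgebraic_const semialgebraic_conj)

section \<open>Fourier--Motzkin elimination\<close>

text \<open>A solution exists iff every lower bound \<open>- \<beta> c / \<alpha> c\<close> with
  \<open>\<alpha> c > 0\<close> is at most every upper bound \<open>- \<beta> d / \<alpha> d\<close>
  with \<open>\<alpha> d < 0\<close>. Clearing denominators keeps the condition polynomial in the
  coefficients.\<close>

lemma one_variable_elimination:
  fixes \<alpha> \<beta> :: "'c \<Rightarrow> real"
  assumes "finite C"
  shows "(\<exists>x. \<forall>c\<in>C. G c \<longrightarrow> 0 \<le> \<alpha> c * x + \<beta> c) \<longleftrightarrow>
    (\<forall>c\<in>C. G c \<and> \<alpha> c = 0 \<longrightarrow> 0 \<le> \<beta> c) \<and>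
    (\<forall>c\<in>C. \<forall>d\<in>C. G c \<and> G d \<and> \<alpha> c > 0 \<and> \<alpha> d < 0 \<longrightarrow> 0 \<le> \<alpha> c * \<beta> d - \<alpha> d * \<beta> c)"
    (is "?L \<longleftrightarrow> ?R")
proof
  assume ?L
  then obtain x where x: "\<And>c. c \<in> C \<Longrightarrow> G c \<Longrightarrow> 0 \<le> \<alpha> c * x + \<beta> c"
    by blast
  have "0 \<le> \<alpha> c * \<beta> d - \<alpha> d * \<beta> c"
    if "c \<in> C" "d \<in> C" "G c" "G d" "\<alpha> c > 0" "\<alpha> d < 0" for c d
  proof -
    have "0 \<le> \<alpha> c * (\<alpha> d * x + \<beta> d) + (- \<alpha> d) * (\<alpha> c * x + \<beta> c)"
      using that by (intro add_nonneg_nonneg mult_nonneg_nonneg x) auto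
    also have "\<dots> = \<alpha> c * \<beta> d - \<alpha> d * \<beta> c"
      by (simp add: algebra_simps)
    finally show ?thesis .
  qed
  with x show ?R
    by fastforce
next
  assume R: ?R
  let ?low = "(\<lambda>c. - \<beta> c / \<alpha> c) ` {c \<in> C. G c \<and> \<alpha> c > 0}"
  let ?upp = "(\<lambda>c. - \<beta> c / \<alpha> c) ` {c \<in> C. G c \<and> \<alpha> c < 0}"
  have fin: "finite ?low" "finite ?upp"
    using assms by auto
  have sep: "l \<le> u" if "l \<in> ?low" "u \<in> ?upp" for l u
    using that R by (fastforce simp: divide_simps mult_ac)
  \<comment> \<open>Witness: the largest lower bound, or the smallest upper bound if there is no
    lower one.\<close>
  have "\<exists>x. (\<forall>l\<in>?low. l \<le> x) \<and> (\<forall>u\<in>?upp. x \<le> u)"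
  proof (cases "?low = {}")
    case True
    have "\<exists>x. \<forall>u\<in>?upp. x \<le> u"
    proof (cases "?upp = {}")
      case False
      then show ?thesis
        using fin(2) by (intro exI[of _ "Min ?upp"]) simp
    qed blast
    then show ?thesis
      using True by auto
  next
    case False
    then show ?thesis
      using fin(1) sep Max_in[OF fin(1) False] Max_ge[OF fin(1)] by blast
  qed
  then obtain x where x: "\<And>l. l \<in> ?low \<Longrightarrow> l \<le> x" "\<And>u. u \<in> ?upp \<Longrightarrow> x \<le> u"
    by blast
  have "0 \<le> \<alpha> c * x + \<beta> c" if c: "c \<in> C" "G c" for c
  proof (cases "\<alpha> c" "0 :: real" rule: linorder_cases)
    case equal
    then show ?thesis
      using R c by auto
  next
    case less
    then have "x \<le> - \<beta> c / \<alpha> c"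
      using c by (intro x) auto
    with less show ?thesis
      by (simp add: field_simps)
  next
    case greater
    then have "- \<beta> c / \<alpha> c \<le> x"
      using c by (intro x) auto
    with greater show ?thesis
      by (simp add: field_simps)
  qed
  then show ?L
    by blast
qed

text \<open>
  Each constraint carries a guard \<open>g\<close>. The guards absorb the case distinctions on the signs of the
  leading coefficients, so that a single system results from each elimination step.
\<close>

lemma semialgebraic_linear_system:
  assumes "finite C"
    and "\<And>g a b. (g, a, b) \<in> C \<Longrightarrow> semialgebraic k g \<and> (\<forall>j<m. polyfun k (a j)) \<and> polyfun k b"
  shows "semialgebraic k (\<lambda>p :: nat \<Rightarrow> real ^ 'd::finite.
    \<exists>x :: nat \<Rightarrow> real. \<forall>(g, a, b)\<in>C. g p \<longrightarrow> 0 \<le> (\<Sum>j<m. a j p * x j) + b p)"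
  using assms
proof (induction m arbitrary: C)
  case 0
  have "semialgebraic k (\<lambda>p. \<forall>c\<in>C. fst c p \<longrightarrow> 0 \<le> snd (snd c) p)"
    using 0 by (intro semialgebraic_Ball semialgebraic_imp semialgebraic_nonneg) auto
  then show ?case
    by (simp add: case_prod_beta)
next
  case (Suc m)
  \<comment> \<open>\<open>?flat\<close> treats the constraints in which variable \<open>m\<close>
    has coefficient 0; \<open>?comb\<close> is the positive combination of a lower and an upper
    bound in which variable \<open>m\<close> cancels.\<close>
  let ?flat = "\<lambda>(g, a, b). (\<lambda>p. g p \<and> a m p = 0, a, b)"
  let ?comb = "\<lambda>((g, a, b), (g', a', b')).
    (\<lambda>p. (g p \<and> g' p) \<and> a m p > 0 \<and> a' m p < 0,
     \<lambda>j p. a m p * a' j p - a' m p * a j p, \<lambda>p. a m p * b' p - a' m p * b p)"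
  define C' where "C' = ?flat ` C \<union> ?comb ` (C \<times> C)"
  have "semialgebraic k (\<lambda>p :: nat \<Rightarrow> real ^ 'd.
      \<exists>x :: nat \<Rightarrow> real. \<forall>(g, a, b)\<in>C'. g p \<longrightarrow> 0 \<le> (\<Sum>j<m. a j p * x j) + b p)"
  proof (rule Suc.IH)
    show "finite C'"
      using Suc.prems(1) by (simp add: C'_def)
    fix g a b assume "(g, a, b) \<in> C'"
    then consider (flat) g' where "(g', a, b) \<in> C" "g = (\<lambda>p. g' p \<and> a m p = 0)"
      | (comb) g1 a1 b1 g2 a2 b2 where "(g1, a1, b1) \<in> C" "(g2, a2, b2) \<in> C"
        "g = (\<lambda>p. (g1 p \<and> g2 p) \<and> a1 m p > 0 \<and> a2 m p < 0)"
        "a = (\<lambda>j p. a1 m p * a2 j p - a2 m p * a1 j p)"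
        "b = (\<lambda>p. a1 m p * b2 p - a2 m p * b1 p)"
      unfolding C'_def by auto
    then show "semialgebraic k g \<and> (\<forall>j<m. polyfun k (a j)) \<and> polyfun k b"
    proof cases
      case flat
      with Suc.prems(2)[OF flat(1)] show ?thesis
        by (auto intro!: semialgebraic_conj semialgebraic_eq_0)
    next
      case comb
      with Suc.prems(2)[OF comb(1)] Suc.prems(2)[OF comb(2)] show ?thesis
        by (auto intro!: semialgebraic_conj semialgebraic_pos semialgebraic_neg
            polyfun_diff polyfun_mult)
    qed
  qed
  moreover have "(\<exists>x :: nat \<Rightarrow> real. \<forall>(g, a, b)\<in>C'. g p \<longrightarrow> 0 \<le> (\<Sum>j<m. a j p * x j) + b p) \<longleftrightarrow>
    (\<exists>x :: nat \<Rightarrow> real. \<forall>(g, a, b)\<in>C. g p \<longrightarrow> 0 \<le> (\<Sum>j<Suc m. a j p * x j) + b p)" for p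
  proof -
    let ?rest = "\<lambda>x c. (\<Sum>j<m. fst (snd c) j p * x j) + snd (snd c) p"
    have *: "(\<forall>(g, a, b)\<in>C'. g p \<longrightarrow> 0 \<le> (\<Sum>j<m. a j p * x j) + b p) \<longleftrightarrow>
        (\<exists>t. \<forall>c\<in>C. fst c p \<longrightarrow> 0 \<le> fst (snd c) m p * t + ?rest x c)" for x :: "nat \<Rightarrow> real"
    proof -
      have "(\<Sum>j<m. (a m p * a' j p - a' m p * a j p) * x j) + (a m p * b' p - a' m p * b p) =
          a m p * ((\<Sum>j<m. a' j p * x j) + b' p) - a' m p * ((\<Sum>j<m. a j p * x j) + b p)"
        for a a' :: "nat \<Rightarrow> (nat \<Rightarrow> real ^ 'd) \<Rightarrow> real" and b b' :: "(nat \<Rightarrow> real ^ 'd) \<Rightarrow> real"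
        by (simp add: algebra_simps sum_subtractf sum_distrib_left)
      then show ?thesis
        unfolding one_variable_elimination[OF Suc.prems(1)] C'_def
        by (simp add: ball_Un split_beta image_iff del: split_paired_All)
    qed
    have "(\<exists>x. \<exists>t. \<forall>c\<in>C. fst c p \<longrightarrow> 0 \<le> fst (snd c) m p * t + ?rest x c) \<longleftrightarrow>
        (\<exists>x :: nat \<Rightarrow> real. \<forall>(g, a, b)\<in>C. g p \<longrightarrow> 0 \<le> (\<Sum>j<Suc m. a j p * x j) + b p)" (is "?L = ?R")
    proof
      assume ?L
      then obtain x t where "\<forall>c\<in>C. fst c p \<longrightarrow> 0 \<le> fst (snd c) m p * t + ?rest x c"
        by blast
      then show ?R
        by (intro exI[of _ "x(m := t)"]) (auto simp: split_beta algebra_simps)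
    next
      assume ?R
      then obtain x where "\<forall>(g, a, b)\<in>C. g p \<longrightarrow> 0 \<le> (\<Sum>j<Suc m. a j p * x j) + b p"
        by blast
      then show ?L
        by (intro exI[of _ x] exI[of _ "x m"]) (auto simp: split_beta algebra_simps)
    qed
    then show ?thesis
      unfolding * .
  qed
  ultimately show ?case
    by (simp only:)
qed

section \<open>Tverberg predicates as linear systems\<close>

text \<open>A common point amounts to a solution of a linear system in the convex weights, with
  coefficients that are constants or coordinates of the points. Eliminating the weights leaves sign
  conditions on polynomials in the coordinates.\<close>

lemma semialgebraic_Tv:
  assumes I: "partition_on {1..k} \<I>"
  shows "semialgebraic k (\<lambda>p :: nat \<Rightarrow> real ^ 'd::finite. Tv \<I> p)"
proof -
  let ?T = "\<lambda>p :: nat \<Rightarrow> real ^ 'd. True"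
  let ?c = "\<lambda>(t :: real) (p :: nat \<Rightarrow> real ^ 'd). t"
  define in_part :: "nat set \<Rightarrow> nat \<Rightarrow> (nat \<Rightarrow> real ^ 'd) \<Rightarrow> real"
    where "in_part J = (\<lambda>j p. if j \<in> J then 1 else 0)" for J
  define coord :: "nat set \<Rightarrow> 'd \<Rightarrow> nat \<Rightarrow> (nat \<Rightarrow> real ^ 'd) \<Rightarrow> real"
    where "coord J c = (\<lambda>j p. if j \<in> J then p j $ c else 0)" for J c
  \<comment> \<open>In order: weights are nonnegative; the weights of a part sum to at least 1 and
    to at most 1; any two parts have the same weighted sum of points, each equation arising from
    both orders of the pair. Variable 0, present because sums run over \<open>j<Suc k\<close>,
    always has coefficient 0.\<close>
  define C where "C =
      (\<lambda>i. (?T, in_part {i}, ?c 0)) ` {1..k} \<union>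
      (\<lambda>J. (?T, in_part J, ?c (-1))) ` \<I> \<union>
      (\<lambda>J. (?T, \<lambda>j p. - in_part J j p, ?c 1)) ` \<I> \<union>
      (\<lambda>(J, J', c). (?T, \<lambda>j p. coord J c j p - coord J' c j p, ?c 0)) ` (\<I> \<times> \<I> \<times> UNIV)"
  have finI: "finite \<I>"
    using I finite_elements by blast
  have J: "J \<subseteq> {1..k}" "finite J" if "J \<in> \<I>" for J
    using I that unfolding partition_on_def by (auto intro: finite_subset)
  have in_part: "polyfun k (in_part J j)" for J j
    unfolding in_part_def by (cases "j \<in> J") (simp_all add: polyfun_const)
  have coord: "polyfun k (coord J c j)" if "J \<in> \<I>" for J c j
    unfolding coord_def using J[OF that]
    by (cases "j \<in> J") (auto intro!: polyfun_const polyfun_coord)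
  have "semialgebraic k (\<lambda>p :: nat \<Rightarrow> real ^ 'd.
      \<exists>x :: nat \<Rightarrow> real. \<forall>(g, a, b)\<in>C. g p \<longrightarrow> 0 \<le> (\<Sum>j<Suc k. a j p * x j) + b p)"
  proof (rule semialgebraic_linear_system)
    show "finite C"
      using finI by (simp add: C_def)
    show "semialgebraic k g \<and> (\<forall>j<Suc k. polyfun k (a j)) \<and> polyfun k b" if "(g, a, b) \<in> C" for g a b
      using that unfolding C_def
      by (auto intro!: semialgebraic_const in_part coord polyfun_const polyfun_diff polyfun_uminus)
  qed
  moreover have "(\<exists>x :: nat \<Rightarrow> real. \<forall>(g, a, b)\<in>C. g p \<longrightarrow> 0 \<le> (\<Sum>j<Suc k. a j p * x j) + b p)
      \<longleftrightarrow> Tv \<I> p" for p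
  proof -
    have sum_in: "(\<Sum>j<Suc k. in_part J j p * x j) = sum x J" if "J \<subseteq> {1..k}" for J and x :: "nat \<Rightarrow> real"
    proof -
      have "(\<Sum>j<Suc k. in_part J j p * x j) = (\<Sum>j\<in>{..<Suc k}. if j \<in> J then x j else 0)"
        unfolding in_part_def by (rule sum.cong) auto
      also have "\<dots> = sum x ({..<Suc k} \<inter> J)"
        by (simp add: sum.inter_restrict)
      also have "{..<Suc k} \<inter> J = J"
        using that by auto
      finally show ?thesis .
    qed
    have sum_co: "(\<Sum>j<Suc k. coord J c j p * x j) = (\<Sum>j\<in>J. x j *\<^sub>R p j) $ c"
      if "J \<subseteq> {1..k}" for J c and x :: "nat \<Rightarrow> real"
    proof -
      have "(\<Sum>j<Suc k. coord J c j p * x j) = (\<Sum>j\<in>{..<Suc k}. if j \<in> J then x j * p j $ c else 0)"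
        unfolding coord_def by (rule sum.cong) auto
      also have "\<dots> = (\<Sum>j\<in>{..<Suc k} \<inter> J. x j * p j $ c)"
        by (simp add: sum.inter_restrict)
      also have "{..<Suc k} \<inter> J = J"
        using that by auto
      finally show ?thesis
        by simp
    qed
    have sys: "(\<forall>(g, a, b)\<in>C. g p \<longrightarrow> 0 \<le> (\<Sum>j<Suc k. a j p * x j) + b p) \<longleftrightarrow>
        (\<forall>i\<in>{1..k}. 0 \<le> x i) \<and> (\<forall>J\<in>\<I>. sum x J = 1) \<and>
        (\<forall>J\<in>\<I>. \<forall>J'\<in>\<I>. (\<Sum>j\<in>J. x j *\<^sub>R p j) = (\<Sum>j\<in>J'. x j *\<^sub>R p j))" (is "?L \<longleftrightarrow> ?R") for x
    proof -
      have "?L \<longleftrightarrow> (\<forall>i\<in>{1..k}. 0 \<le> x i) \<and> (\<forall>J\<in>\<I>. 0 \<le> sum x J - 1) \<and> (\<forall>J\<in>\<I>. 0 \<le> 1 - sum x J) \<and>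
          (\<forall>J\<in>\<I>. \<forall>J'\<in>\<I>. \<forall>c. 0 \<le> (\<Sum>j\<in>J. x j *\<^sub>R p j) $ c - (\<Sum>j\<in>J'. x j *\<^sub>R p j) $ c)"
        unfolding C_def using J
        by (simp add: ball_Un sum_in sum_co left_diff_distrib sum_subtractf sum_negf
            del: sum.lessThan_Suc sum_component)
      also have "(\<forall>J\<in>\<I>. 0 \<le> sum x J - 1) \<and> (\<forall>J\<in>\<I>. 0 \<le> 1 - sum x J) \<and> Q \<longleftrightarrow>
          (\<forall>J\<in>\<I>. sum x J = 1) \<and> Q" for Q
        by (auto simp: order_antisym_conv)
      also have "(\<forall>J\<in>\<I>. \<forall>J'\<in>\<I>. \<forall>c. 0 \<le> y J $ c - y J' $ c) \<longleftrightarrow> (\<forall>J\<in>\<I>. \<forall>J'\<in>\<I>. y J = y J')"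
        for y :: "nat set \<Rightarrow> real ^ 'd"
      proof (intro iffI ballI)
        fix J J' assume "\<forall>J\<in>\<I>. \<forall>J'\<in>\<I>. \<forall>c. 0 \<le> y J $ c - y J' $ c" "J \<in> \<I>" "J' \<in> \<I>"
        then show "y J = y J'"
          unfolding vec_eq_iff by (metis diff_ge_0_iff_ge order_antisym)
      next
        fix J J' assume "\<forall>J\<in>\<I>. \<forall>J'\<in>\<I>. y J = y J'" "J \<in> \<I>" "J' \<in> \<I>"
        then have "y J = y J'"
          by blast
        then show "\<forall>c. 0 \<le> y J $ c - y J' $ c"
          by simp
      qed
      finally show ?thesis .
    qed
    show ?thesis
    proof
      assume "\<exists>x :: nat \<Rightarrow> real. \<forall>(g, a, b)\<in>C. g p \<longrightarrow> 0 \<le> (\<Sum>j<Suc k. a j p * x j) + b p"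
      then obtain x where x: "\<forall>i\<in>{1..k}. 0 \<le> x i" "\<forall>J\<in>\<I>. sum x J = 1"
          "\<forall>J\<in>\<I>. \<forall>J'\<in>\<I>. (\<Sum>j\<in>J. x j *\<^sub>R p j) = (\<Sum>j\<in>J'. x j *\<^sub>R p j)"
        unfolding sys by blast
      show "Tv \<I> p"
      proof (cases "\<I> = {}")
        case True
        then show ?thesis
          by (simp add: Tv_def)
      next
        case False
        then obtain J0 where J0: "J0 \<in> \<I>"
          by blast
        have "(\<Sum>j\<in>J0. x j *\<^sub>R p j) \<in> convex hull (p ` J)" if "J \<in> \<I>" for J
        proof -
          have "\<forall>i\<in>J. 0 \<le> x i" "sum x J = 1" "(\<Sum>j\<in>J. x j *\<^sub>R p j) = (\<Sum>j\<in>J0. x j *\<^sub>R p j)"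
            using x that J0 J(1)[OF that] by blast+
          then show ?thesis
            unfolding convex_hull_image_finite[OF J(2)[OF that]] by blast
        qed
        then show ?thesis
          unfolding Tv_def by blast
      qed
    next
      assume "Tv \<I> p"
      then obtain y where "\<forall>J\<in>\<I>. y \<in> convex hull (p ` J)"
        unfolding Tv_def by blast
      then have "\<forall>J\<in>\<I>. \<exists>u. (\<forall>i\<in>J. 0 \<le> u i) \<and> sum u J = 1 \<and> (\<Sum>i\<in>J. u i *\<^sub>R p i) = y"
        using convex_hull_image_finite J(2) by blast
      then obtain u where u: "\<And>J i. J \<in> \<I> \<Longrightarrow> i \<in> J \<Longrightarrow> 0 \<le> u J i"
          "\<And>J. J \<in> \<I> \<Longrightarrow> sum (u J) J = 1" "\<And>J. J \<in> \<I> \<Longrightarrow> (\<Sum>i\<in>J. u J i *\<^sub>R p i) = y"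
        by metis
      \<comment> \<open>Parts are disjoint, so the weights of all parts combine into one vector
        indexed by points.\<close>
      define x where "x i = u (THE J. J \<in> \<I> \<and> i \<in> J) i" for i
      have x: "x i = u J i" if "J \<in> \<I>" "i \<in> J" for J i
      proof -
        have "(THE J. J \<in> \<I> \<and> i \<in> J) = J"
        proof (rule the_equality)
          show "J' = J" if "J' \<in> \<I> \<and> i \<in> J'" for J'
            using that \<open>J \<in> \<I>\<close> \<open>i \<in> J\<close> partition_onD2[OF I] unfolding disjoint_def by blast
        qed (use that in blast)
        then show ?thesis
          by (simp add: x_def)
      qed
      have "0 \<le> x i" if "i \<in> {1..k}" for i
      proof -
        obtain J where "J \<in> \<I>" "i \<in> J"
          using I \<open>i \<in> {1..k}\<close> unfolding partition_on_def by blast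
        then show ?thesis
          using u(1) x by simp
      qed
      moreover have "sum x J = 1" "(\<Sum>j\<in>J. x j *\<^sub>R p j) = y" if "J \<in> \<I>" for J
        using u(2,3)[OF that] x[OF that] by simp_all
      ultimately show "\<exists>x :: nat \<Rightarrow> real. \<forall>(g, a, b)\<in>C. g p \<longrightarrow> 0 \<le> (\<Sum>j<Suc k. a j p * x j) + b p"
        unfolding sys by (intro exI[of _ x]) auto
    qed
  qed
  ultimately show ?thesis
    by (simp only:)
qed

section \<open>Stretched arrays\<close>

text \<open>Division-free form: for rows \<open>k < l\<close> the ratio \<open>x l i / x k i\<close>
  grows by at least the factor \<open>C\<close> from an index to any later one.\<close>

definition stretched :: "real \<Rightarrow> nat \<Rightarrow> nat \<Rightarrow> (nat \<Rightarrow> nat \<Rightarrow> real) \<Rightarrow> bool" where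
  "stretched C D n x \<longleftrightarrow>
     (\<forall>k\<in>{1..D}. \<forall>i\<in>{1..n}. 0 < x k i) \<and>
     (\<forall>k\<in>{1..D}. \<forall>l\<in>{1..D}. \<forall>i\<in>{1..n}. \<forall>j\<in>{1..n}. k < l \<longrightarrow> i < j \<longrightarrow>
        C * (x l i * x k j) \<le> x l j * x k i)"

lemma stretched_pos: "stretched C D n x \<Longrightarrow> k \<in> {1..D} \<Longrightarrow> i \<in> {1..n} \<Longrightarrow> 0 < x k i"
  by (simp add: stretched_def)

lemma stretchedD:
  "stretched C D n x \<Longrightarrow> k \<in> {1..D} \<Longrightarrow> l \<in> {1..D} \<Longrightarrow> i \<in> {1..n} \<Longrightarrow> j \<in> {1..n} \<Longrightarrow>
    k < l \<Longrightarrow> i < j \<Longrightarrow> C * (x l i * x k j) \<le> x l j * x k i"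
  by (simp add: stretched_def)

text \<open>
  Consecutive sets share at most one element, so \<open>D\<close> of them need all \<open>(r - 1) D + 1\<close> elements.
\<close>

lemma consecutive_blocks:
  fixes E :: "nat \<Rightarrow> nat set"
  assumes sub: "\<And>k. k \<in> {1..D} \<Longrightarrow> E k \<subseteq> {1..(r - 1) * D + 1}"
    and card: "\<And>k. k \<in> {1..D} \<Longrightarrow> card (E k) = r"
    and le: "\<And>k l a b. \<lbrakk>k \<in> {1..D}; l \<in> {1..D}; k < l; a \<in> E k; b \<in> E l\<rbrakk> \<Longrightarrow> a \<le> b"
    and k: "k \<in> {1..D}" and r: "1 \<le> r"
  shows "E k = {(r - 1) * (k - 1) + 1..(r - 1) * k + 1}"
proof -
  have lower: "(r - 1) * k + 1 \<le> a" if "Suc k \<in> {1..D}" "a \<in> E (Suc k)" for k a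
    using that
  proof (induction k arbitrary: a)
    case 0
    then show ?case
      using sub[of "Suc 0"] by auto
  next
    case (Suc k)
    \<comment> \<open>The previous set has \<open>r\<close> elements between its own lower bound and
      \<open>a\<close>, which pushes \<open>a\<close> up by \<open>r - 1\<close>.\<close>
    have "E (Suc k) \<subseteq> {(r - 1) * k + 1..a}"
      using Suc.IH le[of "Suc k" "Suc (Suc k)" _ a] Suc.prems by auto
    then have "card (E (Suc k)) \<le> card {(r - 1) * k + 1..a}"
      by (rule card_mono[rotated]) simp
    moreover have "(r - 1) * Suc k = (r - 1) * k + (r - 1)"
      by simp
    ultimately show ?case
      using card[of "Suc k"] Suc.prems r by simp
  qed
  \<comment> \<open>The mirror image, by induction on the distance \<open>m\<close> from the last
    set.\<close>
  have upper: "a \<le> (r - 1) * (D - m) + 1" if "D - m \<in> {1..D}" "a \<in> E (D - m)" for m a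
    using that
  proof (induction m arbitrary: a)
    case 0
    then show ?case
      using sub[of D] by auto
  next
    case (Suc m)
    have m: "D - m = Suc (D - Suc m)"
      using Suc.prems by auto
    have "E (D - m) \<subseteq> {a..(r - 1) * (D - m) + 1}"
      using Suc.IH le[of "D - Suc m" "D - m" a] Suc.prems by auto
    then have "card (E (D - m)) \<le> card {a..(r - 1) * (D - m) + 1}"
      by (rule card_mono[rotated]) simp
    moreover have "(r - 1) * (D - m) = (r - 1) * (D - Suc m) + (r - 1)"
      unfolding m by simp
    moreover have "card (E (D - m)) = r"
      using card[of "D - m"] Suc.prems by auto
    ultimately show ?case
      using r by simp linarith
  qed
  have "E k \<subseteq> {(r - 1) * (k - 1) + 1..(r - 1) * k + 1}"
    using lower[of "k - 1"] upper[of "D - k"] k by auto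
  moreover have "card {(r - 1) * (k - 1) + 1..(r - 1) * k + 1} = r"
    using k r by (cases k) auto
  ultimately show ?thesis
    using card[OF k] by (intro card_subset_eq) auto
qed

section \<open>Common points in stretched arrays\<close>

text \<open>
  \<open>e J k\<close> is an index in the part \<open>J\<close> that dominates the \<open>k\<close>-th coordinate of the common point \<open>y\<close>.
  Stretchedness forces the dominating indices of a coordinate to precede those of the next one.
\<close>

lemma colorful_of_common_point:
  fixes y :: "nat \<Rightarrow> real" and \<mu> :: "nat set \<Rightarrow> nat \<Rightarrow> real"
  assumes type: "tverberg_type d r \<I>" and r: "1 \<le> r"
    and str: "stretched C (d + 1) (tverberg_number d r) x"
    and C: "(real (tverberg_number d r))\<^sup>2 < C"
    and \<mu>: "\<And>J i. J \<in> \<I> \<Longrightarrow> i \<in> J \<Longrightarrow> 0 \<le> \<mu> J i"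
    and y: "\<And>k. k \<in> {1..d + 1} \<Longrightarrow> 0 < y k"
    and sum: "\<And>J k. J \<in> \<I> \<Longrightarrow> k \<in> {1..d + 1} \<Longrightarrow> (\<Sum>i\<in>J. \<mu> J i * x k i) = y k"
  shows "colorful d r \<I>"
proof -
  let ?T = "tverberg_number d r"
  have part: "partition_on {1..?T} \<I>" and cardI: "card \<I> = r"
    using type unfolding tverberg_type_def by auto
  have J: "J \<subseteq> {1..?T}" "finite J" "J \<noteq> {}" "card J \<le> ?T" if "J \<in> \<I>" for J
  proof -
    show sub: "J \<subseteq> {1..?T}" and "J \<noteq> {}"
      using part that unfolding partition_on_def by auto
    show "finite J"
      using sub by (rule finite_subset) simp
    show "card J \<le> ?T"
      using card_mono[OF _ sub] by simp
  qed
  have T: "0 < ?T"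
    by (simp add: tverberg_number_def)
  \<comment> \<open>At most \<open>?T\<close> terms sum to \<open>y k\<close>, so one of them is at
    least the fraction \<open>1 / ?T\<close> of it.\<close>
  have "\<exists>i\<in>J. y k \<le> ?T * (\<mu> J i * x k i)" if "J \<in> \<I>" "k \<in> {1..d + 1}" for J k
  proof (rule ccontr)
    assume "\<not> ?thesis"
    then have "(\<Sum>i\<in>J. ?T * (\<mu> J i * x k i)) < real (card J) * y k"
      using J[OF \<open>J \<in> \<I>\<close>] by (intro sum_bounded_above_strict) (auto simp: card_gt_0_iff)
    also have "\<dots> \<le> ?T * y k"
      using J(4)[OF \<open>J \<in> \<I>\<close>] y[OF \<open>k \<in> {1..d + 1}\<close>] by (intro mult_right_mono) auto
    finally show False
      using sum[OF that] by (simp flip: sum_distrib_left)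
  qed
  then obtain e where e: "e J k \<in> J" "y k \<le> ?T * (\<mu> J (e J k) * x k (e J k))"
    if "J \<in> \<I>" "k \<in> {1..d + 1}" for J k
    by metis
  have term_le: "\<mu> J i * x k i \<le> y k" if "J \<in> \<I>" "i \<in> J" "k \<in> {1..d + 1}" for J i k
  proof -
    have "\<mu> J i * x k i \<le> (\<Sum>i\<in>J. \<mu> J i * x k i)"
    proof (rule member_le_sum)
      show "0 \<le> \<mu> J i' * x k i'" if "i' \<in> J - {i}" for i'
      proof (intro mult_nonneg_nonneg)
        have "i' \<in> {1..?T}"
          using J(1)[OF \<open>J \<in> \<I>\<close>] that by blast
        then show "0 \<le> x k i'"
          using stretched_pos[OF str \<open>k \<in> {1..d + 1}\<close>] by (simp add: less_imp_le)
      qed (use \<mu>[OF \<open>J \<in> \<I>\<close>] that in auto)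
    qed (use that J in auto)
    then show ?thesis
      using sum that by simp
  qed
  \<comment> \<open>If \<open>i = e J' l\<close> came before \<open>j = e J k\<close>, exchanging
    the rows \<open>k\<close> and \<open>l\<close> in the product of the two dominating terms would
    multiply it by at least \<open>C\<close>. The dominating product is at least
    \<open>y k * y l / ?T\<^sup>2\<close> and the exchanged one at most \<open>y k * y l\<close>,
    against the choice of \<open>C\<close>.\<close>
  have le: "e J k \<le> e J' l"
    if "k \<in> {1..d + 1}" "l \<in> {1..d + 1}" "k < l" "J \<in> \<I>" "J' \<in> \<I>" for J J' k l
  proof (rule ccontr)
    define i j where "i = e J' l" and "j = e J k"
    assume "\<not> e J k \<le> e J' l"
    then have "i < j"
      by (simp add: i_def j_def)
    have ij: "i \<in> J'" "j \<in> J"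
      using e(1) that by (auto simp: i_def j_def)
    then have ijT: "i \<in> {1..?T}" "j \<in> {1..?T}"
      using J(1) that by blast+
    note pos = stretched_pos[OF str]
    let ?m = "\<mu> J' i * \<mu> J j"
    have m: "0 \<le> ?m"
      using \<mu> ij that by simp
    have "y k * y l \<le> (?T * (\<mu> J j * x k j)) * (?T * (\<mu> J' i * x l i))"
      using e(2)[of J k] e(2)[of J' l] that y[of k] y[of l] unfolding i_def j_def
      by (intro mult_mono) auto
    also have "\<dots> = ?T\<^sup>2 * (?m * (x l i * x k j))"
      by (simp add: power2_eq_square mult_ac)
    finally have lower: "y k * y l \<le> ?T\<^sup>2 * (?m * (x l i * x k j))" .
    have "C * (?m * (x l i * x k j)) \<le> ?m * (x l j * x k i)"
      using mult_left_mono[OF stretchedD[OF str that(1,2) ijT that(3) \<open>i < j\<close>] m] by (simp add: mult_ac)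
    also have "\<dots> = (\<mu> J' i * x k i) * (\<mu> J j * x l j)"
      by (simp add: mult_ac)
    also have "\<dots> \<le> y k * y l"
    proof (rule mult_mono[OF term_le term_le])
      show "0 \<le> \<mu> J j * x l j"
        using \<mu>[of J j] pos[of l j] that ij ijT by simp
    qed (use that ij y[of k] in auto)
    finally have "C * (?m * (x l i * x k j)) \<le> ?T\<^sup>2 * (?m * (x l i * x k j))"
      using lower by simp
    moreover have "0 < ?m * (x l i * x k j)"
    proof -
      have "0 < y k * y l"
        using y that by simp
      also note lower
      finally show ?thesis
        by (simp add: zero_less_mult_iff)
    qed
    ultimately show False
      using C by (simp add: mult_le_cancel_right)
  qed
  define E where "E k = (\<lambda>J. e J k) ` \<I>" for k
  have disj: "J = J'" if "J \<in> \<I>" "J' \<in> \<I>" "i \<in> J" "i \<in> J'" for i J J'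
    using partition_onD2[OF part] that unfolding disjoint_def by blast
  have E: "E k = {(r - 1) * (k - 1) + 1..(r - 1) * k + 1}" if "k \<in> {1..d + 1}" for k
  proof (rule consecutive_blocks[where D = "d + 1"])
    fix k assume k: "k \<in> {1..d + 1}"
    show "E k \<subseteq> {1..(r - 1) * (d + 1) + 1}"
      using e(1)[OF _ k] J(1) unfolding E_def tverberg_number_def by auto
    have "inj_on (\<lambda>J. e J k) \<I>"
      using e(1)[OF _ k] disj by (intro inj_onI) metis
    then show "card (E k) = r"
      unfolding E_def using cardI by (simp add: card_image)
  qed (use that r le in \<open>auto simp: E_def\<close>)
  show ?thesis
    unfolding colorful_def
  proof (intro ballI)
    fix k J assume k: "k \<in> {1..d + 1}" and JI: "J \<in> \<I>"
    show "\<exists>!i. i \<in> {(r - 1) * (k - 1) + 1..(r - 1) * k + 1} \<and> i \<in> J"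
      unfolding E[OF k, symmetric]
    proof (rule ex1I[of _ "e J k"])
      show "e J k \<in> E k \<and> e J k \<in> J"
        using e(1) k JI by (simp add: E_def)
      fix i assume "i \<in> E k \<and> i \<in> J"
      then obtain J' where "J' \<in> \<I>" "i = e J' k" "i \<in> J"
        by (auto simp: E_def)
      with disj[of J J' i] e(1)[of J' k] k JI show "i = e J k"
        by simp
    qed
  qed
qed

section \<open>Separating functionals on stretched arrays\<close>

lemma sum_split:
  fixes f :: "nat \<Rightarrow> 'a::comm_monoid_add"
  assumes "a \<le> b" "b \<le> c"
  shows "sum f {a + 1..c} = sum f {a + 1..b} + sum f {b + 1..c}"
proof -
  have "{a + 1..c} = {a + 1..b} \<union> {b + 1..c}" "{a + 1..b} \<inter> {b + 1..c} = {}"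
    using assms by auto
  then show ?thesis
    by (simp add: sum.union_disjoint)
qed

text \<open>
  \<open>P k\<close> is the largest \<open>k\<close>-th coefficient, and \<open>\<iota> k\<close> is the element in block \<open>k\<close> of a part
  with a negative \<open>k\<close>-th coefficient of comparable size. Positivity there forces the coordinates
  beyond \<open>k\<close> to outweigh those up to \<open>k\<close>; for the last \<open>k\<close> there is nothing beyond.
\<close>

lemma no_separating_functionals:
  fixes c :: "nat set \<Rightarrow> nat \<Rightarrow> real"
  assumes type: "tverberg_type d r \<I>" and r: "1 \<le> r" and col: "colorful d r \<I>"
    and str: "stretched C (d + 1) (tverberg_number d r) x" and C: "16 * (real r)\<^sup>2 \<le> C"
    and c0: "\<And>k. k \<in> {1..d + 1} \<Longrightarrow> (\<Sum>J\<in>\<I>. c J k) = 0"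
    and pos: "\<And>J i. J \<in> \<I> \<Longrightarrow> i \<in> J \<Longrightarrow> 0 < (\<Sum>k\<in>{1..d + 1}. c J k * x k i)"
  shows False
proof -
  define D where "D = d + 1"
  then have D: "D \<in> {1..D}"
    by simp
  note str = str[folded D_def] and c0 = c0[folded D_def] and pos = pos[folded D_def]
  let ?T = "tverberg_number d r"
  have part: "partition_on {1..?T} \<I>" and cardI: "card \<I> = r"
    using type unfolding tverberg_type_def by auto
  have finI: "finite \<I>" and neI: "\<I> \<noteq> {}"
    using cardI r by (auto intro: card_ge_0_finite)
  have J: "J \<subseteq> {1..?T}" "J \<noteq> {}" if "J \<in> \<I>" for J
    using part that unfolding partition_on_def by auto
  have disj: "J = J'" if "J \<in> \<I>" "J' \<in> \<I>" "i \<in> J" "i \<in> J'" for i J J'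
    using partition_onD2[OF part] that unfolding disjoint_def by blast
  have xpos: "0 < x k i" if "k \<in> {1..D}" "i \<in> {1..?T}" for k i
    using stretched_pos[OF str that] .
  define P where "P k = Max ((\<lambda>J. c J k) ` \<I>)" for k
  have c_le: "c J k \<le> P k" if "J \<in> \<I>" for J k
    unfolding P_def using finI that by simp
  have P_in: "\<exists>J\<in>\<I>. c J k = P k" for k
  proof -
    have "P k \<in> (\<lambda>J. c J k) ` \<I>"
      unfolding P_def using finI neI by (intro Max_in) auto
    then show ?thesis
      by auto
  qed
  have P0: "0 \<le> P k" if "k \<in> {1..D}" for k
  proof -
    have "0 = (\<Sum>J\<in>\<I>. c J k)"
      using c0[OF that] by simp
    also have "\<dots> \<le> (\<Sum>J\<in>\<I>. P k)"
      using c_le by (intro sum_mono)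
    also have "\<dots> = real r * P k"
      using cardI by simp
    finally show ?thesis
      using r by (simp add: zero_le_mult_iff)
  qed
  \<comment> \<open>The numbers \<open>c J k + P k / r\<close> sum to \<open>P k\<close>. If all of
    them were positive, the one with \<open>c J k = P k\<close> would alone exceed this sum.\<close>
  have "\<exists>J\<in>\<I>. c J k \<le> - P k / r" if k: "k \<in> {1..D}" for k
  proof (rule ccontr)
    assume "\<not> ?thesis"
    then have gt: "0 < c J k + P k / r" if "J \<in> \<I>" for J
      using that by force
    obtain J0 where J0: "J0 \<in> \<I>" "c J0 k = P k"
      using P_in by blast
    have "c J0 k + P k / r \<le> (\<Sum>J\<in>\<I>. c J k + P k / r)"
      using gt J0 finI by (intro member_le_sum) (auto intro: less_imp_le)
    also have "\<dots> = P k"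
      using c0[OF k] cardI r by (simp add: sum.distrib)
    finally show False
      using gt[OF J0(1)] J0(2) P0[OF k] r by (simp add: field_simps)
  qed
  then obtain jj where jj: "jj k \<in> \<I>" "c (jj k) k \<le> - P k / r" if "k \<in> {1..D}" for k
    by metis
  have "\<exists>i. i \<in> jj k \<and> i \<in> {(r - 1) * (k - 1) + 1..(r - 1) * k + 1}" if "k \<in> {1..D}" for k
    using col jj(1)[OF that] that unfolding colorful_def D_def by blast
  then obtain \<iota> where \<iota>: "\<iota> k \<in> jj k" "(r - 1) * (k - 1) + 1 \<le> \<iota> k" "\<iota> k \<le> (r - 1) * k + 1"
    if "k \<in> {1..D}" for k
    by (metis atLeastAtMost_iff)
  have \<iota>T: "\<iota> k \<in> {1..?T}" if "k \<in> {1..D}" for k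
    using \<iota>(1) jj(1) J(1) that by blast
  \<comment> \<open>\<open>w q i\<close> bounds \<open>c J q * x q i\<close> for every part
    \<open>J\<close>; \<open>low\<close> and \<open>high\<close> collect these bounds up to row
    \<open>k\<close> and beyond it.\<close>
  define w where "w q i = P q * x q i" for q i
  define low where "low k i = (\<Sum>q\<in>{1..k}. w q i)" for k i
  define high where "high k i = (\<Sum>q\<in>{k + 1..D}. w q i)" for k i
  have w0: "0 \<le> w q i" if "q \<in> {1..D}" "i \<in> {1..?T}" for q i
    unfolding w_def using P0 xpos that by (simp add: less_imp_le)
  have low0: "0 \<le> low k i" if "k \<le> D" "i \<in> {1..?T}" for k i
    unfolding low_def using w0 that by (intro sum_nonneg) auto
  have high0: "0 \<le> high k i" if "i \<in> {1..?T}" for k i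
    unfolding high_def using w0 that by (intro sum_nonneg) auto
  have stretch: "C * (high k i * low k j) \<le> high k j * low k i"
    if k: "k \<le> D" and ij: "i \<in> {1..?T}" "j \<in> {1..?T}" "i < j" for k i j
  proof -
    have "C * (high k i * low k j) = C * (\<Sum>l\<in>{k + 1..D}. \<Sum>q\<in>{1..k}. (P l * x l i) * (P q * x q j))"
      unfolding low_def high_def w_def sum_product ..
    also have "\<dots> = (\<Sum>l\<in>{k + 1..D}. \<Sum>q\<in>{1..k}. P l * P q * (C * (x l i * x q j)))"
      by (simp add: sum_distrib_left mult_ac)
    also have "\<dots> \<le> (\<Sum>l\<in>{k + 1..D}. \<Sum>q\<in>{1..k}. P l * P q * (x l j * x q i))"
      using stretchedD[OF str] P0 k ij by (intro sum_mono mult_left_mono) auto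
    also have "\<dots> = high k j * low k i"
      unfolding low_def high_def w_def sum_product by (intro sum.cong refl) (simp add: mult_ac)
    finally show ?thesis .
  qed
  have balance: "(\<Sum>q\<in>{m + 1..k}. w q i) \<le> r * (low m i + high k i)"
    if mk: "m \<le> k" "k \<le> D" and Ji: "J \<in> \<I>" "i \<in> J" and neg: "\<And>q. q \<in> {m + 1..k} \<Longrightarrow> c J q \<le> - P q / r"
    for m k J i
  proof -
    have i: "i \<in> {1..?T}"
      using J Ji by blast
    have split: "(\<Sum>q\<in>{1..D}. f q) = (\<Sum>q\<in>{1..m}. f q) + (\<Sum>q\<in>{m + 1..k}. f q) + (\<Sum>q\<in>{k + 1..D}. f q)"
      for f :: "nat \<Rightarrow> real"
      using sum_split[of 0 m D f] sum_split[of m k D f] mk by simp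
    have "0 < (\<Sum>q\<in>{1..D}. c J q * x q i)"
      using pos Ji by simp
    also have "\<dots> = (\<Sum>q\<in>{1..m}. c J q * x q i) + (\<Sum>q\<in>{m + 1..k}. c J q * x q i) +
        (\<Sum>q\<in>{k + 1..D}. c J q * x q i)"
      by (rule split)
    also have "\<dots> \<le> low m i + (\<Sum>q\<in>{m + 1..k}. - w q i / r) + high k i"
    proof (intro add_mono)
      show "(\<Sum>q\<in>{m + 1..k}. c J q * x q i) \<le> (\<Sum>q\<in>{m + 1..k}. - w q i / r)"
      proof (rule sum_mono)
        fix q assume q: "q \<in> {m + 1..k}"
        then have "c J q * x q i \<le> - P q / r * x q i"
          using neg xpos[of q i] i mk by (intro mult_right_mono) auto
        then show "c J q * x q i \<le> - w q i / r"
          by (simp add: w_def)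
      qed
      have "c J q * x q i \<le> w q i" if "q \<in> {1..D}" for q
        unfolding w_def using c_le Ji xpos[OF that i] by (intro mult_right_mono) auto
      then show "(\<Sum>q\<in>{1..m}. c J q * x q i) \<le> low m i"
          "(\<Sum>q\<in>{k + 1..D}. c J q * x q i) \<le> high k i"
        unfolding low_def high_def using mk by (auto intro!: sum_mono)
    qed
    also have "(\<Sum>q\<in>{m + 1..k}. - w q i / r) = - (\<Sum>q\<in>{m + 1..k}. w q i) / r"
      by (simp add: sum_divide_distrib sum_negf)
    finally show ?thesis
      using r by (simp add: field_simps)
  qed
  \<comment> \<open>Passing from \<open>i'\<close> to the later index \<open>i\<close> improves the
    bound on \<open>low m\<close> by the factor \<open>C\<close>. As \<open>C\<close> is at least
    \<open>16 * r\<^sup>2\<close>, this and \<open>balance\<close> allow rows \<open>m + 1\<close>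
    to \<open>k\<close> to join the lower part with the same constant \<open>2 * r\<close>.\<close>
  have step: "low k i \<le> 2 * r * high k i"
    if mk: "m \<le> k" "k \<le> D" and Ji: "J \<in> \<I>" "i \<in> J"
      and neg: "\<And>q. q \<in> {m + 1..k} \<Longrightarrow> c J q \<le> - P q / r"
      and IH: "m = 0 \<or> (\<exists>i'\<in>{1..?T}. i' < i \<and> low m i' \<le> 2 * r * high m i')"
    for m k J i
  proof -
    have i: "i \<in> {1..?T}"
      using J Ji by blast
    have CL: "C * low m i \<le> 2 * r * high m i"
    proof (cases "m = 0")
      case True
      then show ?thesis
        using high0[OF i] by (simp add: low_def)
    next
      case False
      then obtain i' where i': "i' \<in> {1..?T}" "i' < i" "low m i' \<le> 2 * r * high m i'"
        using IH by blast
      have m: "m \<le> D"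
        using mk by simp
      show ?thesis
      \<comment> \<open>If \<open>high m i'\<close> is 0 it cannot be cancelled; but then
        \<open>P q = 0\<close> for all rows up to \<open>m\<close>, so \<open>low m\<close> vanishes
        at \<open>i\<close> too.\<close>
      proof (cases "high m i' = 0")
        case True
        then have "low m i' = 0"
          using i' low0[OF m i'(1)] by simp
        then have "w q i' = 0" if "q \<in> {1..m}" for q
          using that m i'(1) w0 unfolding low_def by (subst (asm) sum_nonneg_eq_0_iff) auto
        then have "w q i = 0" if "q \<in> {1..m}" for q
          using that m i'(1) xpos[of q i'] unfolding w_def by fastforce
        then show ?thesis
          using high0[OF i] by (simp add: low_def)
      next
        case False
        then have h: "0 < high m i'"
          using high0[OF i'(1), of m] by simp
        have "high m i' * (C * low m i) \<le> high m i * low m i'"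
          using stretch[OF m i'(1) i i'(2)] by (simp add: mult_ac)
        also have "\<dots> \<le> high m i * (2 * r * high m i')"
          using i'(3) high0[OF i] by (rule mult_left_mono)
        also have "\<dots> = high m i' * (2 * r * high m i)"
          by simp
        finally show ?thesis
          using h by (simp only: mult_le_cancel_left_pos)
      qed
    qed
    define S where "S = (\<Sum>q\<in>{m + 1..k}. w q i)"
    have lowk: "low k i = low m i + S"
      using sum_split[of 0 m k] mk by (simp add: low_def S_def)
    have highm: "high m i = S + high k i"
      using sum_split[of m k D] mk by (simp add: high_def S_def)
    define L H \<rho> where "L = low m i" and "H = high k i" and "\<rho> = real r"
    have \<rho>: "1 \<le> \<rho>"
      using r by (simp add: \<rho>_def)
    have L: "0 \<le> L" and H: "0 \<le> H"
      using low0[of m i] high0[of i k] mk i by (auto simp: L_def H_def)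
    have "16 * \<rho>\<^sup>2 * L \<le> C * L"
      using C L by (intro mult_right_mono) (auto simp: \<rho>_def)
    also have "\<dots> \<le> 2 * \<rho> * (S + H)"
      using CL highm by (simp add: L_def H_def \<rho>_def)
    finally have "(2 * \<rho>) * (8 * (\<rho> * L)) \<le> (2 * \<rho>) * (S + H)"
      by (simp add: power2_eq_square mult_ac)
    then have 1: "8 * (\<rho> * L) \<le> S + H"
      using \<rho> by (simp add: mult_le_cancel_left_pos)
    have 2: "S \<le> \<rho> * L + \<rho> * H"
      using balance[OF mk Ji neg] unfolding S_def L_def H_def \<rho>_def by (simp add: distrib_left)
    have 3: "L \<le> \<rho> * L" "H \<le> \<rho> * H" "0 \<le> \<rho> * H"
      using \<rho> L H by (simp_all add: mult_le_cancel_right1)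
    have "L + S \<le> 2 * (\<rho> * H)"
      using 1 2 3 by linarith
    then show ?thesis
      using lowk by (simp add: L_def H_def \<rho>_def mult_ac)
  qed
  show False
  \<comment> \<open>For \<open>r = 1\<close> all blocks consist of the index 1, so the indices
    \<open>\<iota> k\<close> never advance; the only part then has all coefficients 0.\<close>
  proof (cases "r = 1")
    case True
    then obtain J0 where "\<I> = {J0}"
      using cardI card_1_singletonE by blast
    then obtain i where "i \<in> J0" "0 < (\<Sum>k\<in>{1..D}. c J0 k * x k i)" "\<forall>k\<in>{1..D}. c J0 k = 0"
      using J(2) pos c0 by fastforce
    then show False
      by simp
  next
    case False
    have claim: "low k (\<iota> k) \<le> 2 * r * high k (\<iota> k)" if "k \<in> {1..D}" for k
      using that
    proof (induction k rule: less_induct)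
      case (less k)
      show ?case
      \<comment> \<open>Consecutive blocks share an endpoint. If
        \<open>\<iota> (k - 1) = \<iota> k\<close>, the parts chosen for both rows coincide and the
        two rows are absorbed together, with \<open>m = k - 2\<close>; otherwise
        \<open>m = k - 1\<close>.\<close>
      proof (cases "k = 1 \<or> \<iota> (k - 1) < \<iota> k")
        case True
        have "k - 1 = 0 \<or> (\<exists>i'\<in>{1..?T}. i' < \<iota> k \<and> low (k - 1) i' \<le> 2 * r * high (k - 1) i')"
        proof (cases "k = 1")
          case False
          then have "k - 1 \<in> {1..D}" "k - 1 < k"
            using less.prems by auto
          then show ?thesis
            using True False less.IH[of "k - 1"] \<iota>T[of "k - 1"]
            by (intro disjI2 bexI[of _ "\<iota> (k - 1)"]) auto
        qed simp
        moreover have "c (jj k) q \<le> - P q / r" if "q \<in> {k - 1 + 1..k}" for q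
        proof -
          have "q = k"
            using that less.prems by auto
          then show ?thesis
            using less.prems jj(2) by simp
        qed
        ultimately show ?thesis
          using less.prems jj(1) \<iota>(1) by (intro step[of "k - 1" k "jj k" "\<iota> k"]) auto
      next
        case False
        then have k: "k \<ge> 2" "k - 1 \<in> {1..D}"
          using less.prems by auto
        have eq: "\<iota> (k - 1) = \<iota> k"
          using False \<iota>(3)[OF k(2)] \<iota>(2)[OF less.prems] by simp
        have jeq: "jj (k - 1) = jj k"
          using disj[of "jj (k - 1)" "jj k" "\<iota> k"] jj(1) \<iota>(1) k(2) less.prems eq by metis
        have "k - 2 = 0 \<or> (\<exists>i'\<in>{1..?T}. i' < \<iota> k \<and> low (k - 2) i' \<le> 2 * r * high (k - 2) i')"
        proof (cases "k = 2")
          case False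
          then have k2: "k - 2 \<in> {1..D}" "k - 1 = Suc (k - 2)"
            using k by auto
          have "\<iota> (k - 2) \<le> (r - 1) * (k - 2) + 1"
            using \<iota>(3) k2 by simp
          also have "\<dots> < (r - 1) * (k - 1) + 1"
            unfolding k2(2) using \<open>r \<noteq> 1\<close> r by simp
          also have "\<dots> \<le> \<iota> k"
            using \<iota>(2) less.prems by simp
          finally show ?thesis
            using less.IH[of "k - 2"] k2 k(1) \<iota>T[of "k - 2"]
            by (intro disjI2 bexI[of _ "\<iota> (k - 2)"]) auto
        qed simp
        moreover have "c (jj k) q \<le> - P q / r" if "q \<in> {k - 2 + 1..k}" for q
        proof -
          have "q = k \<or> q = k - 1"
            using that k by auto
          then show ?thesis
            using less.prems k(2) jj(2)[of k] jj(2)[of "k - 1"] jeq by auto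
        qed
        ultimately show ?thesis
          using less.prems jj(1) \<iota>(1) by (intro step[of "k - 2" k "jj k" "\<iota> k"]) auto
      qed
    qed
    \<comment> \<open>\<open>high D\<close> is an empty sum, so all bounds \<open>w\<close> vanish
      at \<open>\<iota> D\<close>; hence no coefficient is positive, contrary to
      \<open>pos\<close>.\<close>
    have "low D (\<iota> D) = 0"
      using claim[of D] low0[of D "\<iota> D"] \<iota>T[of D] D by (simp add: high_def)
    then have "w q (\<iota> D) = 0" if "q \<in> {1..D}" for q
      using that D \<iota>T[of D] w0 unfolding low_def by (subst (asm) sum_nonneg_eq_0_iff) auto
    then have Pz: "P q = 0" if "q \<in> {1..D}" for q
      using that D \<iota>T[of D] xpos[of q "\<iota> D"] unfolding w_def by fastforce
    obtain J0 i where "J0 \<in> \<I>" "i \<in> J0"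
      using neI J(2) by blast
    then have "0 < (\<Sum>k\<in>{1..D}. c J0 k * x k i)" "i \<in> {1..?T}"
      using pos J by blast+
    moreover have "(\<Sum>k\<in>{1..D}. c J0 k * x k i) \<le> 0"
    proof (rule sum_nonpos)
      fix k assume "k \<in> {1..D}"
      then show "c J0 k * x k i \<le> 0"
        using c_le[OF \<open>J0 \<in> \<I>\<close>, of k] Pz xpos[of k i] \<open>i \<in> {1..?T}\<close>
        by (intro mult_nonpos_nonneg) auto
    qed
    ultimately show False
      by simp
  qed
qed

section \<open>Homogeneous subsets\<close>

text \<open>An \<open>e\<close>-element set is represented by its increasing list, so
  \<open>P\<close> may refer to the order of the indices.\<close>

definition homogeneous :: "(nat list \<Rightarrow> bool) \<Rightarrow> nat \<Rightarrow> nat set \<Rightarrow> bool" where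
  "homogeneous P e H \<longleftrightarrow>
     (\<forall>xs. strict_sorted xs \<and> set xs \<subseteq> H \<and> length xs = e \<longrightarrow> P xs) \<or>
     (\<forall>xs. strict_sorted xs \<and> set xs \<subseteq> H \<and> length xs = e \<longrightarrow> \<not> P xs)"

lemma homogeneous_mono: "homogeneous P e H \<Longrightarrow> H' \<subseteq> H \<Longrightarrow> homogeneous P e H'"
  unfolding homogeneous_def by blast

lemma ramsey_homogeneous:
  "\<exists>N. \<forall>P X. finite X \<and> N \<le> card X \<longrightarrow> (\<exists>H\<subseteq>X. card H = m \<and> homogeneous P e H)"
proof -
  obtain N :: nat where N: "partn_lst {..<N} [m, m] e"
    using ramsey_full by blast
  have "\<exists>H\<subseteq>X. card H = m \<and> homogeneous P e H" if X: "finite X" "N \<le> card X" for P X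
  proof -
    obtain Y where Y: "Y \<subseteq> X" "card Y = N"
      using obtain_subset_with_card_n X by metis
    then have "finite Y"
      using X finite_subset by blast
    then obtain b where b: "bij_betw b {..<N} Y"
      using Y ex_bij_betw_nat_finite[of Y] by (auto simp: atLeast0LessThan)
    \<comment> \<open>The bijection \<open>b\<close> need not be monotone, since the colour of
      \<open>A\<close> is read off from the sorted list of its image.\<close>
    define f where "f A = (if P (sorted_list_of_set (b ` A)) then 0 else 1 :: nat)" for A
    have "f \<in> nsets {..<N} e \<rightarrow> {..<2}"
      by (auto simp: f_def)
    then obtain c H where H: "c < length [m, m]" "H \<in> nsets {..<N} ([m, m] ! c)" "f ` nsets H e \<subseteq> {c}"
      using partn_lstE[OF N] by (metis One_nat_def Suc_1 length_Cons list.size(3))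
    then have H': "H \<subseteq> {..<N}" "card H = m" "finite H"
      by (auto simp: nsets_def less_Suc_eq)
    have inj: "inj_on b H"
      using b H'(1) inj_on_subset by (auto simp: bij_betw_def)
    have "P xs \<longleftrightarrow> c = 0" if xs: "strict_sorted xs" "set xs \<subseteq> b ` H" "length xs = e" for xs
    proof -
      obtain A where A: "A \<subseteq> H" "set xs = b ` A"
        using xs(2) subset_imageE by metis
      have "card A = e"
        using A xs(1,3) inj card_image inj_on_subset distinct_card strict_sorted_iff by metis
      then have "A \<in> nsets H e"
        using A(1) H'(3) finite_subset by (auto simp: nsets_def)
      then have "f A = c"
        using H(3) by blast
      moreover have "sorted_list_of_set (b ` A) = xs"
        using xs(1) A(2) sorted_list_of_set.idem_if_sorted_distinct strict_sorted_iff by metis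
      ultimately show ?thesis
        by (auto simp: f_def split: if_splits)
    qed
    then have "homogeneous P e (b ` H)"
      unfolding homogeneous_def by blast
    moreover have "b ` H \<subseteq> X"
      using b H'(1) Y(1) by (auto simp: bij_betw_def)
    moreover have "card (b ` H) = m"
      using inj H'(2) by (simp add: card_image)
    ultimately show ?thesis
      by blast
  qed
  then show ?thesis
    by blast
qed

text \<open>One application of Ramsey's theorem for each member of \<open>K\<close>; homogeneity
  passes to subsets, and the bound does not depend on the predicates.\<close>

lemma ramsey_homogeneous_family:
  assumes "finite K"
  shows "\<exists>N. \<forall>P X. finite X \<and> N \<le> card X \<longrightarrow>
    (\<exists>H\<subseteq>X. card H = m \<and> (\<forall>k\<in>K. homogeneous (P k) e H))"
  using assms
proof (induction K)
  case empty
  then show ?case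
    by (auto intro!: exI[of _ m] dest: obtain_subset_with_card_n)
next
  case (insert k K)
  obtain N where N: "\<And>P X. finite X \<Longrightarrow> N \<le> card X \<Longrightarrow>
      \<exists>H\<subseteq>X. card H = m \<and> (\<forall>k\<in>K. homogeneous (P k) e H)"
    using insert.IH by blast
  obtain N' where N': "\<And>P X. finite X \<Longrightarrow> N' \<le> card X \<Longrightarrow>
      \<exists>H\<subseteq>X. card H = N \<and> homogeneous P e H"
    using ramsey_homogeneous[of N e] by blast
  have "\<exists>H\<subseteq>X. card H = m \<and> (\<forall>k\<in>insert k K. homogeneous (P k) e H)"
    if X: "finite X" "N' \<le> card X" for P X
  proof -
    obtain Y where Y: "Y \<subseteq> X" "card Y = N" "homogeneous (P k) e Y"
      using N'[OF X] by blast
    then obtain H where "H \<subseteq> Y" "card H = m" "\<forall>k\<in>K. homogeneous (P k) e H"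
      using N[of Y P] X finite_subset by blast
    then show ?thesis
      using Y homogeneous_mono by (intro exI[of _ H]) auto
  qed
  then show ?case
    by blast
qed

lemma strict_sorted_append3:
  fixes A M B :: "'a::linorder list"
  assumes "strict_sorted (A @ M @ B)"
    and "strict_sorted A'" "strict_sorted M'" "strict_sorted B'"
    and "set A' \<subseteq> set A" "set M' \<subseteq> set M" "set B' \<subseteq> set B"
  shows "strict_sorted (A' @ M' @ B')" "set (A' @ M' @ B') \<subseteq> set (A @ M @ B)"
proof -
  have *: "\<forall>a\<in>set A. \<forall>b\<in>set M \<union> set B. a < b" "\<forall>a\<in>set M. \<forall>b\<in>set B. a < b"
    using assms(1) by (auto simp: sorted_wrt_append)
  have "\<forall>a\<in>set A'. \<forall>b\<in>set M' \<union> set B'. a < b"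
    using *(1) assms(5-7) by blast
  moreover have "\<forall>a\<in>set M'. \<forall>b\<in>set B'. a < b"
    using *(2) assms(6,7) by blast
  ultimately show "strict_sorted (A' @ M' @ B')"
    using assms(2-4) by (simp add: sorted_wrt_append)
  show "set (A' @ M' @ B') \<subseteq> set (A @ M @ B)"
    using assms(5-7) by auto
qed

section \<open>Normal vectors of hyperplanes\<close>

text \<open>Dual form of the condition that the vectors at any \<open>DIM('a)\<close> distinct
  indices form a basis.\<close>

definition general_position :: "(nat \<Rightarrow> 'a::euclidean_space) \<Rightarrow> nat set \<Rightarrow> bool" where
  "general_position v S \<longleftrightarrow>
     (\<forall>X w. X \<subseteq> S \<and> card X = DIM('a) \<and> (\<forall>x\<in>X. w \<bullet> v x = 0) \<longrightarrow> w = 0)"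

lemma general_position_list:
  fixes v :: "nat \<Rightarrow> 'a::euclidean_space"
  assumes "general_position v S" "distinct xs" "set xs \<subseteq> S" "length xs = DIM('a)"
    and "\<And>x. x \<in> set xs \<Longrightarrow> w \<bullet> v x = 0"
  shows "w = 0"
  using assms distinct_card[of xs] unfolding general_position_def by metis

text \<open>The choice fixes neither sign nor scale, so the predicates built from it use only
  products and ratios that are insensitive to both.\<close>

definition normal :: "(nat \<Rightarrow> 'a::euclidean_space) \<Rightarrow> nat list \<Rightarrow> 'a" where
  "normal v xs = (SOME w. w \<noteq> 0 \<and> (\<forall>x\<in>set xs. w \<bullet> v x = 0))"

lemma normal:
  fixes v :: "nat \<Rightarrow> 'a::euclidean_space"
  assumes "length xs < DIM('a)"
  shows "normal v xs \<noteq> 0" "x \<in> set xs \<Longrightarrow> normal v xs \<bullet> v x = 0"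
proof -
  have "dim (v ` set xs) \<le> card (v ` set xs)"
    by (rule dim_le_card') simp
  also have "\<dots> \<le> length xs"
    using card_image_le[of "set xs" v] card_length[of xs] by simp
  finally have "dim (v ` set xs) < DIM('a)"
    using assms by simp
  then obtain w where "w \<noteq> 0" "\<And>y. y \<in> span (v ` set xs) \<Longrightarrow> orthogonal w y"
    using orthogonal_to_subspace_exists by blast
  then have "\<exists>w. w \<noteq> 0 \<and> (\<forall>x\<in>set xs. w \<bullet> v x = 0)"
    by (auto simp: orthogonal_def span_base)
  from someI_ex[OF this] show "normal v xs \<noteq> 0" "x \<in> set xs \<Longrightarrow> normal v xs \<bullet> v x = 0"
    unfolding normal_def by blast+
qed

lemma inner_normal_nonzero:
  fixes v :: "nat \<Rightarrow> 'a::euclidean_space"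
  assumes "general_position v S" "distinct (x # xs)" "set (x # xs) \<subseteq> S" "length (x # xs) = DIM('a)"
  shows "normal v xs \<bullet> v x \<noteq> 0"
proof
  assume "normal v xs \<bullet> v x = 0"
  then have "normal v xs = 0"
    using assms normal(2)[of xs _ v] by (intro general_position_list[OF assms]) auto
  then show False
    using normal(1)[of xs v] assms(4) by simp
qed

text \<open>The further index \<open>x\<close> lies off the hyperplane and fixes the factor; the
  difference then vanishes at \<open>DIM('a)\<close> indices.\<close>

lemma normal_unique:
  fixes v :: "nat \<Rightarrow> 'a::euclidean_space"
  assumes "general_position v S" "distinct (x # xs)" "set (x # xs) \<subseteq> S" "length (x # xs) = DIM('a)"
    and w: "\<And>y. y \<in> set xs \<Longrightarrow> w \<bullet> v y = 0"
  obtains c where "w = c *\<^sub>R normal v xs"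
proof
  let ?c = "(w \<bullet> v x) / (normal v xs \<bullet> v x)"
  have "w - ?c *\<^sub>R normal v xs = 0"
    using inner_normal_nonzero[OF assms(1-4)] w normal(2)[of xs _ v] assms(4)
    by (intro general_position_list[OF assms(1-4)]) (auto simp: inner_diff_left)
  then show "w = ?c *\<^sub>R normal v xs"
    by simp
qed

text \<open>Meant for lists of length \<open>DIM('a) + 1\<close>: without the entries at
  \<open>k\<close> and \<open>k + 1\<close>, just enough points remain to span a hyperplane.\<close>

definition same_side :: "(nat \<Rightarrow> 'a::euclidean_space) \<Rightarrow> nat \<Rightarrow> nat list \<Rightarrow> bool" where
  "same_side v k xs \<longleftrightarrow>
     (let w = normal v (take k xs @ drop (k + 2) xs) in 0 < (w \<bullet> v (xs ! k)) * (w \<bullet> v (xs ! (k + 1))))"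

lemma same_side_append:
  "length A = k \<Longrightarrow> same_side v k (A @ [i, j] @ B) \<longleftrightarrow>
    0 < (normal v (A @ B) \<bullet> v i) * (normal v (A @ B) \<bullet> v j)"
  by (simp add: same_side_def nth_append Let_def)

lemma sorted_list_in_set:
  assumes "finite H" "n \<le> card (H :: nat set)"
  obtains xs where "strict_sorted xs" "set xs \<subseteq> H" "length xs = n"
proof
  let ?xs = "take n (sorted_list_of_set H)"
  show "strict_sorted ?xs"
    by (rule sorted_wrt_take) simp
  show "set ?xs \<subseteq> H"
    using assms set_take_subset[of n "sorted_list_of_set H"] by simp
  show "length ?xs = n"
    using assms by simp
qed

text \<open>Three points avoid the hyperplane through \<open>DIM('a) - 1\<close> others, so two of
  them are on the same side of it; hence the constant truth value on \<open>H\<close> cannot be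
  \<open>False\<close>.\<close>

lemma homogeneous_same_side:
  fixes v :: "nat \<Rightarrow> 'a::euclidean_space"
  assumes gp: "general_position v H" and H: "finite H" "DIM('a) + 2 \<le> card H"
    and hom: "homogeneous (same_side v k) (DIM('a) + 1) H"
    and xs: "strict_sorted (A @ [i, j] @ B)" "set (A @ [i, j] @ B) \<subseteq> H" "length A = k"
      "length (A @ [i, j] @ B) = DIM('a) + 1"
  shows "0 < (normal v (A @ B) \<bullet> v i) * (normal v (A @ B) \<bullet> v j)"
proof (rule ccontr)
  assume "\<not> ?thesis"
  then have neg: "\<not> same_side v k ys"
    if "strict_sorted ys" "set ys \<subseteq> H" "length ys = DIM('a) + 1" for ys
    using hom xs same_side_append[OF xs(3)] that unfolding homogeneous_def by metis
  obtain L where L: "strict_sorted L" "set L \<subseteq> H" "length L = DIM('a) + 2"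
    using sorted_list_in_set[OF H] by blast
  have "length (drop k L) = Suc (Suc (Suc (length B)))"
    using L xs by simp
  then obtain x y z B' where "drop k L = x # y # z # B'" "length B' = length B"
    unfolding length_Suc_conv by blast
  moreover define A' where "A' = take k L"
  moreover have "L = take k L @ drop k L"
    by simp
  moreover have "length A' = k"
    using L xs by (simp add: A'_def)
  ultimately have L': "L = A' @ [x, y, z] @ B'" "length A' = k" "length B' = length B"
    by auto
  define f where "f u = normal v (A' @ B') \<bullet> v u" for u
  have ne: "f u \<noteq> 0" if "u \<in> {x, y, z}" for u
    unfolding f_def
    using that L L' xs by (intro inner_normal_nonzero[OF gp]) (auto simp: strict_sorted_iff)
  have "\<not> 0 < f u * f u'" if "(u, u') \<in> {(x, y), (y, z), (x, z)}" for u u'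
    using that neg[of "A' @ [u, u'] @ B'"] L L' xs
    unfolding same_side_append[OF L'(2)] f_def by (auto simp: sorted_wrt_append)
  then have "\<not> 0 < f x * f y" "\<not> 0 < f y * f z" "\<not> 0 < f x * f z"
    by auto
  then show False
    using ne[of x] ne[of y] ne[of z] by (auto simp: zero_less_mult_iff)
qed

section \<open>Large cross ratios\<close>

text \<open>
  If all cross ratios of an increasing sequence were at most \<open>C\<close>, then all its inner gaps would be
  comparable, and at the same time the first of them would be comparable to their sum.
\<close>

lemma large_cross_ratio:
  fixes t :: "nat \<Rightarrow> real"
  assumes t: "\<And>i j. i < j \<Longrightarrow> j < n \<Longrightarrow> t i < t j" and n: "C\<^sup>2 + 4 < n" and C: "0 \<le> C"
  obtains x y z u where "x < y" "y < z" "z < u" "u < n"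
    "C * ((t y - t x) * (t u - t z)) < (t z - t x) * (t u - t y)"
proof (rule ccontr)
  assume "\<not> thesis"
  with that have le: "(t z - t x) * (t u - t y) \<le> C * ((t y - t x) * (t u - t z))"
    if "x < y" "y < z" "z < u" "u < n" for x y z u
    using that by (meson not_le)
  have left: "t z - t y \<le> C * (t y - t x)" if *: "x < y" "y < z" "z < u" "u < n" for x y z u
  proof -
    have "(t z - t y) * (t u - t z) \<le> (t z - t x) * (t u - t y)"
      using t[of x y] t[of y z] t[of z u] * by (intro mult_mono) auto
    also note le[OF *]
    finally have "(t z - t y) * (t u - t z) \<le> (C * (t y - t x)) * (t u - t z)"
      by (simp add: mult_ac)
    then show ?thesis
      using t[of z u] * by (simp add: mult_le_cancel_right)
  qed
  have right: "t z - t y \<le> C * (t u - t z)" if *: "x < y" "y < z" "z < u" "u < n" for x y z u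
  proof -
    have "(t y - t x) * (t z - t y) \<le> (t z - t x) * (t u - t y)"
      using t[of x y] t[of y z] t[of z u] * by (intro mult_mono) auto
    also note le[OF *]
    finally have "(t y - t x) * (t z - t y) \<le> (t y - t x) * (C * (t u - t z))"
      by (simp add: mult_ac)
    then show ?thesis
      using t[of x y] * by (simp add: mult_le_cancel_left)
  qed
  have n4: "4 < n"
    using n zero_le_power2[of C] by linarith
  \<comment> \<open>The indices 0 and \<open>n - 1\<close> are kept as outermost points:
    \<open>gap\<close> uses \<open>right\<close> with \<open>x = 0\<close>, and the final estimate
    uses \<open>left\<close> with \<open>u = n - 1\<close>.\<close>
  let ?g = "t 2 - t 1"
  have g: "0 < ?g"
    using t[of 1 2] n4 by simp
  have gap: "?g \<le> C * (t (Suc l) - t l)" if l: "2 \<le> l" "l < n - 2" for l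
  proof -
    have "l < n"
      using l by linarith
    then have "?g \<le> t l - t 1"
      using t[of 2 l] l by (cases "l = 2") auto
    also have "\<dots> \<le> C * (t (Suc l) - t l)"
      using l by (intro right[of 0]) auto
    finally show ?thesis .
  qed
  have "real (n - 4) * ?g = (\<Sum>l\<in>{2..<n - 2}. ?g)"
    by simp
  also have "\<dots> \<le> (\<Sum>l\<in>{2..<n - 2}. C * (t (Suc l) - t l))"
    using gap by (intro sum_mono) auto
  also have "\<dots> = C * (t (n - 2) - t 2)"
    using n4 by (simp add: sum_Suc_diff' flip: sum_distrib_left)
  also have "\<dots> \<le> C * (C * ?g)"
    using left[of 1 2 "n - 2" "n - 1"] n4 C by (intro mult_left_mono) auto
  also have "\<dots> = C\<^sup>2 * ?g"
    by (simp add: power2_eq_square)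
  finally have "real (n - 4) \<le> C\<^sup>2"
    using g by (simp add: mult_le_cancel_right)
  then show False
    using n n4 by simp
qed

text \<open>With \<open>x\<close>, \<open>y\<close>, \<open>z\<close>, \<open>u\<close> at positions
  \<open>k\<close> to \<open>k + 3\<close>, this compares \<open>g / f\<close> at \<open>z\<close>
  and at \<open>y\<close>, where \<open>f\<close> vanishes at \<open>u\<close> and \<open>g\<close>
  at \<open>x\<close>.\<close>

definition large_cross :: "real \<Rightarrow> (nat \<Rightarrow> 'a::euclidean_space) \<Rightarrow> nat \<Rightarrow> nat list \<Rightarrow> bool" where
  "large_cross C v k xs \<longleftrightarrow>
     (let f = normal v (take k xs @ [xs ! (k + 3)] @ drop (k + 4) xs);
          g = normal v (take k xs @ [xs ! k] @ drop (k + 4) xs);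
          y = xs ! (k + 1); z = xs ! (k + 2)
      in C < (g \<bullet> v z) * (f \<bullet> v y) / ((g \<bullet> v y) * (f \<bullet> v z)))"

lemma large_cross_append:
  "length A = k \<Longrightarrow> large_cross C v k (A @ [x, y, z, u] @ B) \<longleftrightarrow>
    C < (normal v (A @ [x] @ B) \<bullet> v z) * (normal v (A @ [u] @ B) \<bullet> v y) /
        ((normal v (A @ [x] @ B) \<bullet> v y) * (normal v (A @ [u] @ B) \<bullet> v z))"
  by (simp add: large_cross_def nth_append Let_def)

text \<open>
  The normal vectors of the hyperplanes through \<open>A\<close>, \<open>B\<close> and one further point \<open>x\<close> span a plane.
  With respect to a basis \<open>\<phi>\<close>, \<open>\<psi>\<close> of it, the values in \<open>large_cross\<close> are differences of
  \<open>t = \<psi> / \<phi>\<close> up to factors that cancel, so \<open>large_cross\<close> speaks about cross ratios of the reals \<open>t\<close>.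
\<close>

lemma homogeneous_large_cross:
  fixes v :: "nat \<Rightarrow> 'a::euclidean_space"
  assumes gp: "general_position v H" and H: "finite H" "DIM('a) + n \<le> card H"
    and n: "C\<^sup>2 + 4 < real n" and C: "0 \<le> C"
    and side: "\<And>A i j B. \<lbrakk>strict_sorted (A @ [i, j] @ B); set (A @ [i, j] @ B) \<subseteq> H;
      length (A @ [i, j] @ B) = DIM('a) + 1\<rbrakk> \<Longrightarrow>
      0 < (normal v (A @ B) \<bullet> v i) * (normal v (A @ B) \<bullet> v j)"
    and hom: "homogeneous (large_cross C v k) (DIM('a) + 2) H" and k: "k + 1 < DIM('a)"
    and xs: "strict_sorted xs" "set xs \<subseteq> H" "length xs = DIM('a) + 2"
  shows "large_cross C v k xs"
proof (rule ccontr)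
  assume "\<not> ?thesis"
  then have neg: "\<not> large_cross C v k ys"
    if "strict_sorted ys" "set ys \<subseteq> H" "length ys = DIM('a) + 2" for ys
    using hom xs that unfolding homogeneous_def by metis
  let ?D = "DIM('a)"
  obtain L where L: "strict_sorted L" "set L \<subseteq> H" "length L = (?D - 2) + Suc n"
  proof (rule sorted_list_in_set[OF H(1)])
    show "(?D - 2) + Suc n \<le> card H"
      using H(2) k by linarith
  qed
  define A M B where "A = take k L" and "M = take (Suc n) (drop k L)" and "B = drop (k + Suc n) L"
  have L_eq: "L = A @ M @ B"
    unfolding A_def M_def B_def by (metis add.commute append_take_drop_id drop_drop)
  have len: "length A = k" "length M = Suc n" "length B = ?D - 2 - k"
    using L k by (auto simp: A_def M_def B_def)
  have sort: "strict_sorted (A @ map ((!) M) is @ B)" and sub: "set (A @ map ((!) M) is @ B) \<subseteq> H"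
    if "strict_sorted is" "set is \<subseteq> {..n}" for "is"
  proof -
    have "strict_sorted M"
      using L(1) unfolding L_eq by (simp add: sorted_wrt_append)
    define Ms where "Ms = map ((!) M) is"
    have "strict_sorted Ms"
      unfolding Ms_def sorted_wrt_map
    proof (rule sorted_wrt_mono_rel[OF _ that(1)])
      fix i j assume "i \<in> set is" "j \<in> set is" "i < j"
      then show "M ! i < M ! j"
        using that(2) len(2) sorted_wrt_nth_less[OF \<open>strict_sorted M\<close>, of i j] by auto
    qed
    moreover have "set Ms \<subseteq> set M"
      using that len by (auto simp: Ms_def)
    moreover have "strict_sorted A" "strict_sorted B"
      using L(1) unfolding L_eq by (simp_all add: sorted_wrt_append)
    ultimately have "strict_sorted (A @ Ms @ B)" "set (A @ Ms @ B) \<subseteq> H"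
      using strict_sorted_append3[OF L(1)[unfolded L_eq], of A Ms B] L(2) unfolding L_eq by auto
    then show "strict_sorted (A @ map ((!) M) is @ B)" "set (A @ map ((!) M) is @ B) \<subseteq> H"
      by (simp_all add: Ms_def)
  qed
  \<comment> \<open>\<open>M ! n\<close> is set aside to define \<open>\<phi>\<close>, which is
    therefore nonzero at \<open>M ! i\<close> for \<open>i < n\<close>, so that the quotients
    \<open>t i\<close> make sense there.\<close>
  define \<phi> \<psi> where "\<phi> = normal v (A @ [M ! n] @ B)" and "\<psi> = normal v (A @ [M ! 0] @ B)"
  have len1: "length (A @ [x] @ B) = ?D - 1" for x
    using len k by simp
  have dist: "distinct (A @ map ((!) M) is @ B)" if "strict_sorted is" "set is \<subseteq> {..n}" for "is"
    using sort[OF that] by (simp add: strict_sorted_iff)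
  have nz: "normal v (A @ [M ! i] @ B) \<bullet> v (M ! j) \<noteq> 0" if "i \<le> n" "j \<le> n" "i \<noteq> j" for i j
  proof -
    define a b where "a = min i j" and "b = max i j"
    have "strict_sorted [a, b]" "set [a, b] \<subseteq> {..n}"
      using that by (auto simp: a_def b_def)
    from dist[OF this] sub[OF this] show ?thesis
      using that len k
      by (intro inner_normal_nonzero[OF gp]) (auto simp: a_def b_def min_def max_def split: if_splits)
  qed
  have n4: "4 < n"
    using n zero_le_power2[of C] by linarith
  define p q t where "p i = \<phi> \<bullet> v (M ! i)" and "q i = \<psi> \<bullet> v (M ! i)" and "t i = q i / p i" for i
  have p: "p i \<noteq> 0" if "i < n" for i
    using nz[of n i] that by (simp add: p_def \<phi>_def)
  \<comment> \<open>\<open>\<omega>\<close> vanishes on \<open>A\<close>, \<open>B\<close> and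
    \<open>M ! i\<close>, so it is a multiple of the normal vector in question; its value at
    \<open>M ! n\<close> shows that the factor is nonzero.\<close>
  have "\<exists>c. \<forall>j<n. c \<noteq> 0 \<and> c * (normal v (A @ [M ! i] @ B) \<bullet> v (M ! j)) = p i * p j * (t j - t i)"
    if i: "i < n" for i
  proof -
    define \<omega> where "\<omega> = p i *\<^sub>R \<psi> - q i *\<^sub>R \<phi>"
    have AB: "\<phi> \<bullet> v x = 0" "\<psi> \<bullet> v x = 0" if "x \<in> set A \<union> set B" for x
      unfolding \<phi>_def \<psi>_def using that len1 k by (intro normal(2); simp)+
    have "\<omega> \<bullet> v y = 0" if "y \<in> set (A @ [M ! i] @ B)" for y
      using that AB[of y] unfolding \<omega>_def by (auto simp: inner_diff_left p_def q_def)
    moreover have "distinct (M ! n # A @ [M ! i] @ B)" "set (M ! n # A @ [M ! i] @ B) \<subseteq> H"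
      using dist[of "[i, n]"] sub[of "[i, n]"] i by auto
    ultimately obtain c where c: "\<omega> = c *\<^sub>R normal v (A @ [M ! i] @ B)"
      using len k by (elim normal_unique[OF gp, rotated 3]) auto
    have "\<omega> \<bullet> v (M ! n) = p i * q n"
      using normal(2)[of "A @ [M ! n] @ B" "M ! n" v] len1 k
      by (simp add: \<omega>_def inner_diff_left q_def \<phi>_def)
    moreover have "q n \<noteq> 0"
      using nz[of 0 n] n4 by (simp add: q_def \<psi>_def)
    ultimately have "c \<noteq> 0"
      using p[OF i] c by auto
    moreover have "c * (normal v (A @ [M ! i] @ B) \<bullet> v (M ! j)) = p i * p j * (t j - t i)" if "j < n" for j
    proof -
      have "c * (normal v (A @ [M ! i] @ B) \<bullet> v (M ! j)) = \<omega> \<bullet> v (M ! j)"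
        unfolding c by simp
      also have "\<dots> = p i * q j - q i * p j"
        by (simp add: \<omega>_def inner_diff_left p_def q_def)
      also have "\<dots> = p i * p j * (t j - t i)"
        using p[OF i] p[OF that] by (simp add: t_def field_simps)
      finally show ?thesis .
    qed
    ultimately show ?thesis
      by blast
  qed
  then obtain c where c0: "\<forall>j<n. c i \<noteq> 0 \<and> c i * (normal v (A @ [M ! i] @ B) \<bullet> v (M ! j)) = p i * p j * (t j - t i)"
    if "i < n" for i
    by metis
  have c: "c i \<noteq> 0" "normal v (A @ [M ! i] @ B) \<bullet> v (M ! j) = p i * p j * (t j - t i) / c i"
    if "i < n" "j < n" for i j
    using c0[OF that(1)] that(2) by (auto simp: nonzero_eq_divide_eq mult.commute)
  have pp: "0 < p i * p j" if "i < j" "j < n" for i j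
    using side[of A "M ! i" "M ! j" "[M ! n] @ B"] sort[of "[i, j, n]"] sub[of "[i, j, n]"] that len k
    by (simp add: p_def \<phi>_def)
  \<comment> \<open>\<open>after\<close> puts later values on one side of \<open>t x\<close>, and
    \<open>before\<close> puts earlier values on one side of \<open>t z\<close>; together they make
    \<open>t\<close> strictly monotone, in the direction \<open>s\<close>.\<close>
  have after: "0 < (t y - t x) * (t z - t x)" if "x < y" "y < z" "z < n" for x y z
  proof -
    have "0 < (p x * p y * (t y - t x) / c x) * (p x * p z * (t z - t x) / c x)"
      using side[of "A @ [M ! x]" "M ! y" "M ! z" B] sort[of "[x, y, z]"] sub[of "[x, y, z]"] that len k
        c(2)[of x y] c(2)[of x z] by simp
    also have "\<dots> = (p x / c x)\<^sup>2 * (p y * p z) * ((t y - t x) * (t z - t x))"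
      by (simp add: power2_eq_square)
    finally show ?thesis
      using mult_nonneg_nonneg[OF zero_le_power2 less_imp_le[OF pp[OF that(2,3)]]]
      by (meson not_le zero_less_mult_iff)
  qed
  have before: "0 < (t x - t z) * (t y - t z)" if "x < y" "y < z" "z < n" for x y z
  proof -
    have "0 < (p z * p x * (t x - t z) / c z) * (p z * p y * (t y - t z) / c z)"
      using side[of A "M ! x" "M ! y" "[M ! z] @ B"] sort[of "[x, y, z]"] sub[of "[x, y, z]"] that len k
        c(2)[of z x] c(2)[of z y] by simp
    also have "\<dots> = (p z / c z)\<^sup>2 * (p x * p y) * ((t x - t z) * (t y - t z))"
      by (simp add: power2_eq_square)
    finally show ?thesis
      using mult_nonneg_nonneg[OF zero_le_power2 less_imp_le[OF pp[of x y]]] that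
      by (meson not_le order_less_trans zero_less_mult_iff)
  qed
  define s where "s = sgn (t (n - 1) - t 0)"
  have ne: "t j \<noteq> t i" if "i < j" "j < n" for i j
    using nz[of i j] c(2)[of i j] that by auto
  have s_mono: "0 < s * (t j - t i)" if "i < j" "j < n" for i j
  proof -
    have "0 < (t j - t i) * (t (n - 1) - t i)"
      using after[of i j "n - 1"] ne[of i j] that by (cases "j = n - 1") (auto simp: zero_less_mult_iff)
    moreover have "0 < (t 0 - t (n - 1)) * (t i - t (n - 1))"
      using before[of 0 i "n - 1"] ne[of 0 "n - 1"] that by (cases "i = 0") (auto simp: zero_less_mult_iff)
    ultimately show ?thesis
      unfolding s_def by (auto simp: zero_less_mult_iff sgn_if split: if_splits)
  qed
  have s2: "s * s = 1"
    using s_mono[of 0 1] n4 by (auto simp: s_def sgn_if split: if_splits)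
  obtain x y z u where xyzu: "x < y" "y < z" "z < u" "u < n"
    and large: "C * ((s * t y - s * t x) * (s * t u - s * t z)) < (s * t z - s * t x) * (s * t u - s * t y)"
    using s_mono by (elim large_cross_ratio[of n "\<lambda>i. s * t i" C, OF _ n C, rotated])
      (auto simp: right_diff_distrib)
  have ss: "(s * a - s * b) * (s * a' - s * b') = (a - b) * (a' - b')" for a b a' b'
  proof -
    have "(s * a - s * b) * (s * a' - s * b') = (s * s) * ((a - b) * (a' - b'))"
      by (simp add: algebra_simps)
    then show ?thesis
      by (simp add: s2)
  qed
  have "0 < (s * t y - s * t x) * (s * t u - s * t z)"
    using s_mono[of x y] s_mono[of z u] xyzu by (simp add: right_diff_distrib)
  then have den: "0 < (t y - t x) * (t u - t z)"
    unfolding ss .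
  have "(p x * p z * (t z - t x) / c x) * (p u * p y * (t y - t u) / c u) /
      ((p x * p y * (t y - t x) / c x) * (p u * p z * (t z - t u) / c u)) =
      (t z - t x) * (t u - t y) / ((t y - t x) * (t u - t z))" (is "?l = ?r")
  proof -
    have "?l = (p x * p z * p u * p y / (c x * c u)) * ((t z - t x) * (t y - t u)) /
        ((p x * p z * p u * p y / (c x * c u)) * ((t y - t x) * (t z - t u)))"
      by (simp add: mult_ac)
    also have "\<dots> = (t z - t x) * (t y - t u) / ((t y - t x) * (t z - t u))"
      using p[of x] p[of y] p[of z] p[of u] c(1)[of x y] c(1)[of u x] xyzu by simp
    also have "\<dots> = - ((t z - t x) * (t u - t y)) / - ((t y - t x) * (t u - t z))"
      by (intro arg_cong2[of _ _ _ _ "(/)"]) (simp_all add: algebra_simps)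
    also have "\<dots> = ?r"
      by simp
    finally show ?thesis .
  qed
  then have "C < (p x * p z * (t z - t x) / c x) * (p u * p y * (t y - t u) / c u) /
      ((p x * p y * (t y - t x) / c x) * (p u * p z * (t z - t u) / c u))"
    using large den unfolding ss by (simp add: pos_less_divide_eq)
  then have "large_cross C v k (A @ [M ! x, M ! y, M ! z, M ! u] @ B)"
    unfolding large_cross_append[OF len(1)] using c(2) xyzu by simp
  moreover have "\<not> large_cross C v k (A @ [M ! x, M ! y, M ! z, M ! u] @ B)"
    using sort[of "[x, y, z, u]"] sub[of "[x, y, z, u]"] xyzu len k by (intro neg) auto
  ultimately show False
    by contradiction
qed


section \<open>Stretched subsequences\<close>

text \<open>Growth factors of adjacent ratios multiply along the rows from \<open>k\<close> to
  \<open>l\<close>; one factor \<open>C\<close> is kept and the others are estimated by 1.\<close>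

lemma stretched_of_adjacent:
  assumes C: "1 \<le> C"
    and pos: "\<And>k i. k \<in> {1..D} \<Longrightarrow> i \<in> {1..n} \<Longrightarrow> 0 < x k i"
    and adj: "\<And>k i j. \<lbrakk>k \<in> {1..D}; Suc k \<in> {1..D}; i \<in> {1..n}; j \<in> {1..n}; i < j\<rbrakk> \<Longrightarrow>
      C * (x (Suc k) i * x k j) \<le> x (Suc k) j * x k i"
  shows "stretched C D n x"
proof -
  have "C * (x l i * x k j) \<le> x l j * x k i"
    if k: "k \<in> {1..D}" and "k < l" "l \<le> D" and ij: "i \<in> {1..n}" "j \<in> {1..n}" "i < j" for k l i j
  proof -
    have "Suc k \<le> l"
      using \<open>k < l\<close> by simp
    then show ?thesis
      using \<open>l \<le> D\<close>
    proof (induction l rule: dec_induct)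
      case base
      then show ?case
        using adj[of k i j] k ij by simp
    next
      case (step l)
      have l: "l \<in> {1..D}" "Suc l \<in> {1..D}"
        using step k by auto
      note p = pos[OF l(1) ij(1)] pos[OF l(1) ij(2)] pos[OF l(2) ij(1)] pos[OF l(2) ij(2)]
        pos[OF k ij(1)] pos[OF k ij(2)]
      have "1 * (x (Suc l) i * x l j) \<le> C * (x (Suc l) i * x l j)"
        using C p by (intro mult_right_mono) auto
      also have "\<dots> \<le> x (Suc l) j * x l i"
        using adj[OF l ij] .
      finally have 1: "x (Suc l) i * x l j \<le> x (Suc l) j * x l i"
        by simp
      have "x l i * (C * (x (Suc l) i * x k j)) = x (Suc l) i * (C * (x l i * x k j))"
        by simp
      also have "\<dots> \<le> x (Suc l) i * (x l j * x k i)"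
        using step p by (intro mult_left_mono) auto
      also have "\<dots> = (x (Suc l) i * x l j) * x k i"
        by simp
      also have "\<dots> \<le> (x (Suc l) j * x l i) * x k i"
        using 1 p by (intro mult_right_mono) auto
      also have "\<dots> = x l i * (x (Suc l) j * x k i)"
        by simp
      finally show ?case
        using p by (simp only: mult_le_cancel_left_pos)
    qed
  qed
  then show ?thesis
    using pos unfolding stretched_def by auto
qed

text \<open>The forms \<open>w k\<close> are normals through initial points \<open>A\<close> and
  final points \<open>B\<close> of a sorted homogeneous list; the \<open>m\<close> points between
  them form the stretched subsequence.\<close>

lemma stretched_subsequence:
  assumes m: "1 \<le> m" and C: "1 \<le> C"
  shows "\<exists>N. \<forall>(v :: nat \<Rightarrow> 'a::euclidean_space) S. general_position v S \<and> finite S \<and> N \<le> card S \<longrightarrow>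
    (\<exists>i w. strict_mono_on {1..m} i \<and> i ` {1..m} \<subseteq> S \<and>
       stretched C DIM('a) m (\<lambda>k l. w k \<bullet> v (i l)) \<and>
       (\<forall>g. \<exists>c. g = (\<Sum>k\<in>{1..DIM('a)}. c k *\<^sub>R w k)))"
proof -
  let ?D = "DIM('a)"
  obtain n :: nat where n: "C\<^sup>2 + 4 < real n"
    using reals_Archimedean2 by blast
  \<comment> \<open>Room for all uses of \<open>H\<close>: \<open>?D + 2\<close> points for sides,
    \<open>?D + n\<close> for cross ratios, \<open>2 * ?D + m - 1\<close> for the list
    \<open>L\<close>.\<close>
  let ?M = "2 * ?D + m + n + 2"
  obtain N1 where N1: "\<And>P X. finite X \<Longrightarrow> N1 \<le> card X \<Longrightarrow>
      \<exists>H\<subseteq>X. card H = ?M \<and> (\<forall>k\<in>{..<?D}. homogeneous (P k) (?D + 2) H)"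
    using ramsey_homogeneous_family[of "{..<?D}" ?M "?D + 2"] by blast
  obtain N where N: "\<And>P X. finite X \<Longrightarrow> N \<le> card X \<Longrightarrow>
      \<exists>H\<subseteq>X. card H = N1 \<and> (\<forall>k\<in>{..<?D}. homogeneous (P k) (?D + 1) H)"
    using ramsey_homogeneous_family[of "{..<?D}" N1 "?D + 1"] by blast
  have "\<exists>i w. strict_mono_on {1..m} i \<and> i ` {1..m} \<subseteq> S \<and>
       stretched C ?D m (\<lambda>k l. w k \<bullet> v (i l)) \<and> (\<forall>g. \<exists>c. g = (\<Sum>k\<in>{1..?D}. c k *\<^sub>R w k))"
    if gpS: "general_position v S" and S: "finite S" "N \<le> card S" for v :: "nat \<Rightarrow> 'a" and S
  proof -
    obtain X where X: "X \<subseteq> S" "card X = N1" "\<forall>k\<in>{..<?D}. homogeneous (same_side v k) (?D + 1) X"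
      using N[OF S, of "same_side v"] by blast
    have finX: "finite X"
      using X(1) S(1) finite_subset by blast
    obtain H where H: "H \<subseteq> X" "card H = ?M" "\<forall>k\<in>{..<?D}. homogeneous (large_cross C v k) (?D + 2) H"
      using N1[OF finX, of "large_cross C v"] X(2) by blast
    have finH: "finite H"
      using H(1) finX finite_subset by blast
    have gp: "general_position v H"
      using gpS H(1) X(1) unfolding general_position_def by blast
    have side: "0 < (normal v (A @ B) \<bullet> v i) * (normal v (A @ B) \<bullet> v j)"
      if "strict_sorted (A @ [i, j] @ B)" "set (A @ [i, j] @ B) \<subseteq> H"
        "length (A @ [i, j] @ B) = ?D + 1" for A i j B
    proof -
      have "length A < ?D"
        using that(3) by simp
      then have "homogeneous (same_side v (length A)) (?D + 1) H"
        using X(3) H(1) homogeneous_mono by blast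
      with gp finH show ?thesis
        using that H(2) by (intro homogeneous_same_side) auto
    qed
    have cross: "large_cross C v k xs"
      if "k + 1 < ?D" "strict_sorted xs" "set xs \<subseteq> H" "length xs = ?D + 2" for k xs
      by (rule homogeneous_large_cross[OF gp finH _ n _ side])
        (use that C H in auto)
    obtain L where L: "strict_sorted L" "set L \<subseteq> H" "length L = ?D + m + (?D - 1)"
      by (rule sorted_list_in_set[OF finH, of "?D + m + (?D - 1)"]) (use H(2) in auto)
    \<comment> \<open>\<open>A\<close> has one point more than the hyperplanes use; it serves for
      the last diagonal value in the spanning argument.\<close>
    define A M B where "A = take ?D L" and "M = take m (drop ?D L)" and "B = drop (?D + m) L"
    have L_eq: "L = A @ M @ B"
      unfolding A_def M_def B_def by (metis add.commute append_take_drop_id drop_drop)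
    have D: "0 < ?D"
      by simp
    have len: "length A = ?D" "length M = m" "length B = ?D - 1"
      using L(3) D unfolding A_def M_def B_def length_take length_drop by linarith+
    have parts: "strict_sorted A" "strict_sorted M" "strict_sorted B" "set A \<subseteq> H" "set M \<subseteq> H" "set B \<subseteq> H"
      using L(1,2) unfolding L_eq by (simp_all add: sorted_wrt_append)
    have sorted_sub: "strict_sorted (take k A @ xs @ drop l B)" "set (take k A @ xs @ drop l B) \<subseteq> H"
      if "strict_sorted xs" "set xs \<subseteq> set M" for k l xs
    proof -
      have "strict_sorted (take k A)" "strict_sorted (drop l B)"
        using parts by (simp_all add: sorted_wrt_take sorted_wrt_drop)
      note * = strict_sorted_append3[OF L(1)[unfolded L_eq] this(1) that(1) this(2)
          set_take_subset that(2) set_drop_subset]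
      show "strict_sorted (take k A @ xs @ drop l B)"
        by (rule *(1))
      show "set (take k A @ xs @ drop l B) \<subseteq> H"
        using *(2) L(2) unfolding L_eq by (rule order_trans)
    qed
    have M_less: "M ! i < M ! j" if "i < j" "j < m" for i j
      using sorted_wrt_nth_less[OF parts(2)] that len by simp
    define f where "f k = normal v (take k A @ drop k B)" for k
    have lenf: "length (take k A @ drop k B) = ?D - 1" if "k < ?D" for k
      using that len by simp
    have f_side: "0 < (f k \<bullet> v (M ! i)) * (f k \<bullet> v (M ! j))" if "k < ?D" "i < m" "j < m" "i \<noteq> j" for k i j
    proof -
      have *: "0 < (f k \<bullet> v (M ! i)) * (f k \<bullet> v (M ! j))" if "i < j" "j < m" for i j
        unfolding f_def
        using that \<open>k < ?D\<close> len M_less[OF that] sorted_sub[of "[M ! i, M ! j]" k k]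
        by (intro side) auto
      show ?thesis
        using *[of i j] *[of j i] that by (cases "i < j") (auto simp: mult.commute)
    qed
    have f_nz: "f k \<bullet> v (M ! i) \<noteq> 0" if "k < ?D" "i < m" for k i
      unfolding f_def using that len sorted_sub[of "[M ! i]" k k]
      by (intro inner_normal_nonzero[OF gp]) (auto simp: strict_sorted_iff)
    \<comment> \<open>The sign makes \<open>w k\<close> positive at the first middle point, hence at
      all of them; the shift by 1 matches rows \<open>1..?D\<close> with \<open>f 0\<close> to
      \<open>f (?D - 1)\<close>.\<close>
    define w where "w k = sgn (f (k - 1) \<bullet> v (M ! 0)) *\<^sub>R f (k - 1)" for k
    define \<iota> where "\<iota> l = M ! (l - 1)" for l
    have pos: "0 < w k \<bullet> v (\<iota> l)" if "k \<in> {1..?D}" "l \<in> {1..m}" for k l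
    proof -
      have kl: "k - 1 < ?D" "l - 1 < m"
        using that unfolding atLeastAtMost_iff by linarith+
      have "0 < (f (k - 1) \<bullet> v (M ! 0)) * (f (k - 1) \<bullet> v (M ! (l - 1)))"
      proof (cases "l - 1 = 0")
        case True
        then show ?thesis
          using f_nz[OF kl] by (simp add: zero_less_mult_iff linorder_neq_iff disj_commute)
      next
        case False
        then show ?thesis
          using kl m by (intro f_side) auto
      qed
      then show ?thesis
        unfolding w_def \<iota>_def by (auto simp: zero_less_mult_iff sgn_if split: if_splits)
    qed
    have "stretched C ?D m (\<lambda>k l. w k \<bullet> v (\<iota> l))"
    proof (rule stretched_of_adjacent[OF C pos])
      fix k i j
      assume k: "k \<in> {1..?D}" "Suc k \<in> {1..?D}" and ij: "i \<in> {1..m}" "j \<in> {1..m}" "i < j"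
      define k' where "k' = k - 1"
      have k': "k = Suc k'" "k' + 1 < ?D"
        using k by (auto simp: k'_def)
      \<comment> \<open>\<open>f k'\<close> passes through \<open>b\<close> where
        \<open>f (Suc k')\<close> passes through \<open>a\<close>, and they share all other points.
        So \<open>large_cross\<close> for \<open>a\<close>, \<open>\<iota> i\<close>,
        \<open>\<iota> j\<close>, \<open>b\<close> speaks about exactly these two forms.\<close>
      define a b B' where "a = A ! k'" and "b = B ! k'" and "B' = drop (Suc k') B"
      have A_eq: "take (Suc k') A = take k' A @ [a]"
        using k' len by (simp add: a_def take_Suc_conv_app_nth)
      have B_eq: "drop k' B = b # B'"
        using k' len by (simp add: b_def B'_def Cons_nth_drop_Suc)
      have "strict_sorted (take k' A @ [a, \<iota> i, \<iota> j, b] @ B')"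
          "set (take k' A @ [a, \<iota> i, \<iota> j, b] @ B') \<subseteq> H"
        using sorted_sub[of "[\<iota> i, \<iota> j]" "Suc k'" k'] M_less[of "i - 1" "j - 1"] ij len
        by (auto simp: A_eq B_eq \<iota>_def)
      then have "large_cross C v k' (take k' A @ [a, \<iota> i, \<iota> j, b] @ B')"
        using k' len by (intro cross) (auto simp: B'_def)
      then have large: "C < (f (Suc k') \<bullet> v (\<iota> j)) * (f k' \<bullet> v (\<iota> i)) /
          ((f (Suc k') \<bullet> v (\<iota> i)) * (f k' \<bullet> v (\<iota> j)))"
        using large_cross_append[of "take k' A" k' C v a "\<iota> i" "\<iota> j" b B'] k' len A_eq B_eq
        by (simp add: f_def B'_def)
      define s s' where "s = sgn (f k' \<bullet> v (M ! 0))" and "s' = sgn (f (Suc k') \<bullet> v (M ! 0))"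
      have w: "w k = s *\<^sub>R f k'" "w (Suc k) = s' *\<^sub>R f (Suc k')"
        by (simp_all add: w_def s_def s'_def k')
      have "s * s' \<noteq> 0"
        using f_nz[of k' 0] f_nz[of "Suc k'" 0] k' m by (simp add: s_def s'_def sgn_zero_iff)
      then have "(f (Suc k') \<bullet> v (\<iota> j)) * (f k' \<bullet> v (\<iota> i)) /
          ((f (Suc k') \<bullet> v (\<iota> i)) * (f k' \<bullet> v (\<iota> j))) =
          ((s * s') * ((f (Suc k') \<bullet> v (\<iota> j)) * (f k' \<bullet> v (\<iota> i)))) /
          ((s * s') * ((f (Suc k') \<bullet> v (\<iota> i)) * (f k' \<bullet> v (\<iota> j))))"
        by simp
      also have "\<dots> = (w (Suc k) \<bullet> v (\<iota> j)) * (w k \<bullet> v (\<iota> i)) /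
          ((w (Suc k) \<bullet> v (\<iota> i)) * (w k \<bullet> v (\<iota> j)))"
        by (simp add: w mult_ac)
      finally have "C < (w (Suc k) \<bullet> v (\<iota> j)) * (w k \<bullet> v (\<iota> i)) /
          ((w (Suc k) \<bullet> v (\<iota> i)) * (w k \<bullet> v (\<iota> j)))"
        using large by simp
      moreover have "0 < (w (Suc k) \<bullet> v (\<iota> i)) * (w k \<bullet> v (\<iota> j))"
        using pos k ij by simp
      ultimately show "C * ((w (Suc k) \<bullet> v (\<iota> i)) * (w k \<bullet> v (\<iota> j))) \<le> (w (Suc k) \<bullet> v (\<iota> j)) * (w k \<bullet> v (\<iota> i))"
        by (simp add: pos_less_divide_eq)
    qed
    moreover have "strict_mono_on {1..m} \<iota>"
      using M_less by (auto intro!: strict_mono_onI simp: \<iota>_def)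
    moreover have "\<iota> ` {1..m} \<subseteq> S"
    proof clarify
      fix l assume "l \<in> {1..m}"
      then have "M ! (l - 1) \<in> set M"
        using len by auto
      then show "\<iota> l \<in> S"
        using parts(5) H(1) X(1) unfolding \<iota>_def by blast
    qed
    \<comment> \<open>The matrix of values \<open>w k \<bullet> v (A ! l)\<close> is triangular with
      nonzero diagonal, so the coefficients are found one after the other; a remainder vanishing on
      all of \<open>A\<close> is 0.\<close>
    moreover have "\<exists>c. g = (\<Sum>k\<in>{1..?D}. c k *\<^sub>R w k)" for g
    proof -
      have ortho: "w k \<bullet> v (A ! l) = 0" if "k \<in> {1..?D}" "l < k - 1" for k l
      proof -
        have "A ! l \<in> set (take (k - 1) A @ drop (k - 1) B)"
          using that len by (auto simp: in_set_conv_nth intro!: exI[of _ l])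
        moreover have "k - 1 < ?D"
          using that(1) unfolding atLeastAtMost_iff by linarith
        then have "length (take (k - 1) A @ drop (k - 1) B) < ?D"
          using lenf[of "k - 1"] D by linarith
        ultimately have "f (k - 1) \<bullet> v (A ! l) = 0"
          unfolding f_def by (intro normal(2))
        then show ?thesis
          by (simp add: w_def)
      qed
      have diag: "w k \<bullet> v (A ! (k - 1)) \<noteq> 0" if k: "k \<in> {1..?D}" for k
      proof -
        have k1: "k - 1 < ?D" "Suc (k - 1) = k"
          using k unfolding atLeastAtMost_iff by linarith+
        have "take k A = take (k - 1) A @ [A ! (k - 1)]"
          using k1 len take_Suc_conv_app_nth[of "k - 1" A] by simp
        moreover have "length (take (k - 1) A @ drop (k - 1) B) + 1 = ?D"
          using lenf[OF k1(1)] D by linarith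
        ultimately have "f (k - 1) \<bullet> v (A ! (k - 1)) \<noteq> 0"
          unfolding f_def using sorted_sub[of "[]" k "k - 1"]
          by (intro inner_normal_nonzero[OF gp]) (auto simp: strict_sorted_iff)
        then show ?thesis
          using f_nz[OF k1(1), of 0] m by (simp add: w_def sgn_zero_iff)
      qed
      have "\<exists>c. \<forall>l<n. (g - (\<Sum>k\<in>{1..n}. c k *\<^sub>R w k)) \<bullet> v (A ! l) = 0" if "n \<le> ?D" for n
        using that
      proof (induction n)
        case 0
        then show ?case
          by simp
      next
        case (Suc n)
        then obtain c where c: "\<And>l. l < n \<Longrightarrow> (g - (\<Sum>k\<in>{1..n}. c k *\<^sub>R w k)) \<bullet> v (A ! l) = 0"
          by auto
        define c' where "c' = c(Suc n := ((g - (\<Sum>k\<in>{1..n}. c k *\<^sub>R w k)) \<bullet> v (A ! n)) / (w (Suc n) \<bullet> v (A ! n)))"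
        have "(\<Sum>k\<in>{1..Suc n}. c' k *\<^sub>R w k) = (\<Sum>k\<in>{1..n}. c k *\<^sub>R w k) + c' (Suc n) *\<^sub>R w (Suc n)"
          by (simp add: c'_def)
        then have "(g - (\<Sum>k\<in>{1..Suc n}. c' k *\<^sub>R w k)) \<bullet> v (A ! l) =
            (g - (\<Sum>k\<in>{1..n}. c k *\<^sub>R w k)) \<bullet> v (A ! l) - c' (Suc n) * (w (Suc n) \<bullet> v (A ! l))" for l
          by (simp add: inner_diff_left inner_add_left)
        then have "(g - (\<Sum>k\<in>{1..Suc n}. c' k *\<^sub>R w k)) \<bullet> v (A ! l) = 0" if "l < Suc n" for l
          using that c[of l] ortho[of "Suc n" l] diag[of "Suc n"] Suc.prems
          by (cases "l = n") (auto simp: c'_def)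
        then show ?case
          by blast
      qed
      then obtain c where c: "\<And>l. l < ?D \<Longrightarrow> (g - (\<Sum>k\<in>{1..?D}. c k *\<^sub>R w k)) \<bullet> v (A ! l) = 0"
        by blast
      have "g - (\<Sum>k\<in>{1..?D}. c k *\<^sub>R w k) = 0"
        using parts(1,4) len c
        by (intro general_position_list[OF gp, of A]) (auto simp: strict_sorted_iff in_set_conv_nth)
      then show ?thesis
        by (intro exI[of _ c]) simp
    qed
    ultimately show ?thesis
      by blast
  qed
  then show ?thesis
    by blast
qed

section \<open>Separation of several convex sets\<close>

text \<open>
  A tuple \<open>z\<close> of points of the sets that minimises the sum of the squared mutual distances yields
  the functionals \<open>g i = (\<Sum>j. z i - z j)\<close>.
\<close>

lemma separation_of_family:
  fixes K :: "'i \<Rightarrow> 'a::euclidean_space set"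
  assumes I: "finite I" "I \<noteq> {}"
    and K: "\<And>i. i \<in> I \<Longrightarrow> compact (K i)" "\<And>i. i \<in> I \<Longrightarrow> convex (K i)" "\<And>i. i \<in> I \<Longrightarrow> K i \<noteq> {}"
    and empty: "(\<Inter>i\<in>I. K i) = {}"
  obtains g b where "(\<Sum>i\<in>I. g i) = 0" "(\<Sum>i\<in>I. b i :: real) = 0"
    "\<And>i x. i \<in> I \<Longrightarrow> x \<in> K i \<Longrightarrow> 0 < g i \<bullet> x + b i"
proof -
  \<comment> \<open>Padding with \<open>{0}\<close> outside \<open>I\<close> makes the tuples
    functions on the whole type, where products of compact sets are compact.\<close>
  define K' where "K' i = (if i \<in> I then K i else {0})" for i
  define E :: "('i \<Rightarrow> 'a) \<Rightarrow> real" where "E z = (\<Sum>i\<in>I. \<Sum>j\<in>I. (norm (z i - z j))\<^sup>2)" for z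
  have "compactin (product_topology (\<lambda>i. euclidean) UNIV) (PiE UNIV K')"
    unfolding compactin_PiE using K(1) by (simp add: K'_def)
  then have "compact (PiE UNIV K')"
    by (simp add: euclidean_product_topology)
  moreover have "PiE UNIV K' \<noteq> {}"
    using K(3) by (simp add: PiE_eq_empty_iff K'_def)
  moreover have "continuous_on (PiE UNIV K') E"
  proof (rule continuous_on_subset[OF _ subset_UNIV])
    show "continuous_on UNIV E"
      unfolding E_def by (intro continuous_intros continuous_on_product_coordinates)
  qed
  ultimately obtain z where z: "z \<in> PiE UNIV K'" "\<And>z'. z' \<in> PiE UNIV K' \<Longrightarrow> E z \<le> E z'"
    using continuous_attains_inf by metis
  have zK: "z i \<in> K i" if "i \<in> I" for i
  proof -
    have "z i \<in> K' i"
      using z(1) by auto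
    then show ?thesis
      using that by (simp add: K'_def)
  qed
  define g where "g i = (\<Sum>j\<in>I. z i - z j)" for i
  have sum_g: "(\<Sum>i\<in>I. g i) = 0"
  proof -
    have "(\<Sum>i\<in>I. g i) = (\<Sum>i\<in>I. \<Sum>j\<in>I. z i) - (\<Sum>i\<in>I. \<Sum>j\<in>I. z j)"
      unfolding g_def by (simp add: sum_subtractf)
    also have "(\<Sum>i\<in>I. \<Sum>j\<in>I. z j) = (\<Sum>i\<in>I. \<Sum>j\<in>I. z i)"
      by (rule sum.swap)
    finally show ?thesis
      by simp
  qed
  have E_split: "E y = 2 * (\<Sum>j\<in>I - {i}. (norm (y i - y j))\<^sup>2) +
      (\<Sum>a\<in>I - {i}. \<Sum>b\<in>I - {i}. (norm (y a - y b))\<^sup>2)" if "i \<in> I" for y i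
    unfolding E_def
    by (simp add: sum.remove[OF I(1) that] sum.distrib norm_minus_commute[of "y i"])
  \<comment> \<open>First-order optimality: moving \<open>z i\<close> a fraction \<open>s\<close> of
    the way to \<open>x\<close> stays inside \<open>K i\<close> and must not decrease
    \<open>E\<close>.\<close>
  have opt: "0 \<le> g i \<bullet> (x - z i)" if i: "i \<in> I" and x: "x \<in> K i" for i x
  proof (rule ccontr)
    define \<delta> where "\<delta> = x - z i"
    define n where "n = real (card (I - {i})) * (norm \<delta>)\<^sup>2"
    assume "\<not> 0 \<le> g i \<bullet> (x - z i)"
    then have neg: "g i \<bullet> \<delta> < 0"
      by (simp add: \<delta>_def)
    have n: "0 \<le> n"
      by (simp add: n_def)
    have gi: "g i \<bullet> \<delta> = (\<Sum>j\<in>I - {i}. (z i - z j) \<bullet> \<delta>)"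
      unfolding g_def by (simp add: sum.remove[OF I(1) i] inner_sum_left)
    have ineq: "0 \<le> 2 * s * (g i \<bullet> \<delta>) + s\<^sup>2 * n" if s: "0 \<le> s" "s \<le> 1" for s
    proof -
      define y where "y = z(i := z i + s *\<^sub>R \<delta>)"
      have "(1 - s) *\<^sub>R z i + s *\<^sub>R x \<in> K i"
        using K(2)[OF i] zK[OF i] x s by (intro convexD) auto
      then have "y i \<in> K i"
        by (simp add: y_def \<delta>_def algebra_simps)
      then have "y j \<in> K' j" for j
        using PiE_mem[OF z(1), of j] i by (cases "j = i") (auto simp: y_def K'_def)
      then have "y \<in> PiE UNIV K'"
        by (intro PiE_I) auto
      from z(2)[OF this] have "(\<Sum>j\<in>I - {i}. (norm (z i - z j))\<^sup>2) \<le> (\<Sum>j\<in>I - {i}. (norm (y i - y j))\<^sup>2)"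
        unfolding E_split[OF i] by (simp add: y_def)
      also have "\<dots> = (\<Sum>j\<in>I - {i}. (norm (z i - z j))\<^sup>2 + 2 * s * ((z i - z j) \<bullet> \<delta>) + s\<^sup>2 * (norm \<delta>)\<^sup>2)"
      proof (rule sum.cong[OF refl])
        fix j assume "j \<in> I - {i}"
        then have yy: "y i - y j = (z i - z j) + s *\<^sub>R \<delta>"
          by (simp add: y_def)
        show "(norm (y i - y j))\<^sup>2 = (norm (z i - z j))\<^sup>2 + 2 * s * ((z i - z j) \<bullet> \<delta>) + s\<^sup>2 * (norm \<delta>)\<^sup>2"
          unfolding yy power2_norm_eq_inner
          by (simp add: inner_add_left inner_add_right inner_commute power2_eq_square algebra_simps)
      qed
      also have "\<dots> = (\<Sum>j\<in>I - {i}. (norm (z i - z j))\<^sup>2) + 2 * s * (g i \<bullet> \<delta>) + s\<^sup>2 * n"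
        unfolding gi n_def by (simp add: sum.distrib sum_distrib_left)
      finally show ?thesis
        by simp
    qed
    \<comment> \<open>So small that the quadratic term is dominated by the negative linear one;
      \<open>n + 1\<close> avoids division by 0.\<close>
    define s where "s = min 1 (- (g i \<bullet> \<delta>) / (n + 1))"
    have s: "0 < s" "s \<le> 1"
      using neg n by (auto simp: s_def intro: divide_neg_pos)
    have "s * n \<le> - (g i \<bullet> \<delta>) / (n + 1) * n"
      using n by (intro mult_right_mono) (auto simp: s_def)
    also have "\<dots> \<le> - (g i \<bullet> \<delta>)"
      using neg n by (simp add: field_simps mult_nonneg_nonpos)
    finally have "s * (2 * (g i \<bullet> \<delta>) + s * n) < 0"
      using neg s by (intro mult_pos_neg) auto
    then show False
      using ineq[of s] s by (simp add: power2_eq_square algebra_simps)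
  qed
  define S where "S = (\<Sum>i\<in>I. g i \<bullet> z i)"
  have "2 * S = E z"
  proof -
    have 1: "S = (\<Sum>i\<in>I. \<Sum>j\<in>I. (z i - z j) \<bullet> z i)"
      unfolding S_def g_def by (simp add: inner_sum_left)
    also have "\<dots> = (\<Sum>i\<in>I. \<Sum>j\<in>I. (z j - z i) \<bullet> z j)"
      by (rule sum.swap)
    finally have "2 * S = (\<Sum>i\<in>I. \<Sum>j\<in>I. (z i - z j) \<bullet> z i + (z j - z i) \<bullet> z j)"
      using 1 by (simp add: sum.distrib)
    also have "\<dots> = E z"
      unfolding E_def power2_norm_eq_inner
      by (intro sum.cong refl) (simp add: inner_simps inner_commute)
    finally show ?thesis .
  qed
  moreover have "0 < E z"
  proof -
    obtain i where i: "i \<in> I"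
      using I by blast
    then obtain j where j: "j \<in> I" "z i \<notin> K j"
      using empty by blast
    then have "0 < (norm (z i - z j))\<^sup>2"
      using zK[OF j(1)] by auto
    also have "\<dots> \<le> (\<Sum>j\<in>I. (norm (z i - z j))\<^sup>2)"
      using I j by (intro member_le_sum) auto
    also have "\<dots> \<le> E z"
      unfolding E_def using I i by (intro member_le_sum[of i I "\<lambda>i. \<Sum>j\<in>I. (norm (z i - z j))\<^sup>2"]) (auto intro: sum_nonneg)
    finally show ?thesis .
  qed
  ultimately have S: "0 < S"
    by simp
  \<comment> \<open>By \<open>opt\<close>, \<open>g i\<close> is minimal on \<open>K i\<close> at
    \<open>z i\<close>. The shift spreads the positive total \<open>S\<close> evenly, so each
    functional is at least \<open>S / card I\<close> on its set.\<close>
  define b where "b i = S / card I - g i \<bullet> z i" for i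
  have "(\<Sum>i\<in>I. b i) = 0"
    using I unfolding b_def by (simp add: sum_subtractf flip: S_def)
  moreover have "0 < g i \<bullet> x + b i" if "i \<in> I" "x \<in> K i" for i x
  proof -
    have "0 < S / card I"
      using S I by (simp add: card_gt_0_iff)
    then show ?thesis
      using opt[OF that] by (simp add: b_def inner_diff_right)
  qed
  ultimately show thesis
    using sum_g that by blast
qed

section \<open>Tverberg types of stretched sequences\<close>

text \<open>Lifting \<open>q i\<close> to \<open>(q i, 1)\<close> turns affine conditions into
  linear ones. A common point \<open>x\<close> gives the row values
  \<open>w k \<bullet> (x, 1)\<close>; if there is none, separating affine functionals are expanded
  in the \<open>w k\<close>.\<close>

lemma Tv_iff_colorful:
  fixes q :: "nat \<Rightarrow> real ^ 'd::finite" and w :: "nat \<Rightarrow> (real ^ 'd) \<times> real"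
  assumes type: "tverberg_type CARD('d) r \<I>" and r: "1 \<le> r"
    and str: "stretched C (CARD('d) + 1) (tverberg_number CARD('d) r) (\<lambda>k i. w k \<bullet> (q i, 1))"
    and C: "(real (tverberg_number CARD('d) r))\<^sup>2 < C" "16 * (real r)\<^sup>2 \<le> C"
    and span: "\<And>g. \<exists>c. g = (\<Sum>k\<in>{1..CARD('d) + 1}. c k *\<^sub>R w k)"
  shows "Tv \<I> q \<longleftrightarrow> colorful CARD('d) r \<I>"
proof -
  let ?T = "tverberg_number CARD('d) r" and ?K = "{1..CARD('d) + 1}"
  have part: "partition_on {1..?T} \<I>" and cardI: "card \<I> = r"
    using type unfolding tverberg_type_def by auto
  have finI: "finite \<I>" and neI: "\<I> \<noteq> {}"
    using cardI r by (auto intro: card_ge_0_finite)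
  have J: "J \<subseteq> {1..?T}" "J \<noteq> {}" "finite J" if "J \<in> \<I>" for J
    using part that finite_subset[of J "{1..?T}"] unfolding partition_on_def by auto
  show ?thesis
  proof
    assume "Tv \<I> q"
    then obtain x where x: "\<And>J. J \<in> \<I> \<Longrightarrow> x \<in> convex hull (q ` J)"
      unfolding Tv_def by blast
    have "\<exists>u. (\<forall>i\<in>J. 0 \<le> u i) \<and> sum u J = 1 \<and> (\<Sum>i\<in>J. u i *\<^sub>R q i) = x" if "J \<in> \<I>" for J
      using x[OF that] convex_hull_image_finite[OF J(3)[OF that]] by blast
    then obtain \<mu> where \<mu>: "\<And>J. J \<in> \<I> \<Longrightarrow> \<forall>i\<in>J. 0 \<le> \<mu> J i" "\<And>J. J \<in> \<I> \<Longrightarrow> sum (\<mu> J) J = 1"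
        "\<And>J. J \<in> \<I> \<Longrightarrow> (\<Sum>i\<in>J. \<mu> J i *\<^sub>R q i) = x"
      by metis
    define y where "y k = w k \<bullet> (x, 1)" for k
    have sum: "(\<Sum>i\<in>J. \<mu> J i * (w k \<bullet> (q i, 1))) = y k" if "J \<in> \<I>" for J k
    proof -
      have "(x, 1) = (\<Sum>i\<in>J. \<mu> J i *\<^sub>R (q i, 1 :: real))"
        using \<mu>(2,3)[OF that] by (intro prod_eqI) (simp_all add: fst_sum snd_sum)
      then show ?thesis
        unfolding y_def by (simp add: inner_sum_right del: inner_Pair scaleR_Pair)
    qed
    obtain J0 where J0: "J0 \<in> \<I>"
      using neI by blast
    have "0 < y k" if k: "k \<in> ?K" for k
    proof -
      have pos: "0 < w k \<bullet> (q i, 1)" if "i \<in> J0" for i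
        using stretched_pos[OF str k] J(1)[OF J0] that by blast
      have "\<exists>i\<in>J0. 0 < \<mu> J0 i"
      proof (rule ccontr)
        assume "\<not> ?thesis"
        then have "sum (\<mu> J0) J0 \<le> 0"
          by (intro sum_nonpos) auto
        then show False
          using \<mu>(2)[OF J0] by simp
      qed
      then obtain i where i: "i \<in> J0" "0 < \<mu> J0 i"
        by blast
      have "0 < (\<Sum>i\<in>J0. \<mu> J0 i * (w k \<bullet> (q i, 1)))"
        using i pos \<mu>(1)[OF J0] J(3)[OF J0]
        by (intro sum_pos2[of J0 i] mult_pos_pos mult_nonneg_nonneg) (auto intro: less_imp_le)
      then show ?thesis
        using sum[OF J0] by simp
    qed
    then show "colorful CARD('d) r \<I>"
      using \<mu>(1) sum by (intro colorful_of_common_point[OF type r str C(1), where \<mu> = \<mu> and y = y]) auto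
  next
    assume col: "colorful CARD('d) r \<I>"
    show "Tv \<I> q"
    proof (rule ccontr)
      assume "\<not> Tv \<I> q"
      then have "(\<Inter>J\<in>\<I>. convex hull (q ` J)) = {}"
        unfolding Tv_def by blast
      moreover have "compact (convex hull (q ` J))" "convex hull (q ` J) \<noteq> {}" if "J \<in> \<I>" for J
        using J[OF that] by (auto intro: finite_imp_compact_convex_hull)
      ultimately obtain g b where g: "(\<Sum>J\<in>\<I>. g J) = 0" "(\<Sum>J\<in>\<I>. b J :: real) = 0"
          "\<And>J x. J \<in> \<I> \<Longrightarrow> x \<in> convex hull (q ` J) \<Longrightarrow> 0 < g J \<bullet> x + b J"
        using separation_of_family[OF finI neI, of "\<lambda>J. convex hull (q ` J)"] by (metis convex_convex_hull)
      obtain J0 where J0: "J0 \<in> \<I>"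
        using neI by blast
      have "\<forall>J. \<exists>c. (g J, b J) = (\<Sum>k\<in>?K. c k *\<^sub>R w k)"
        using span by blast
      then obtain c0 where c0: "\<And>J. (g J, b J) = (\<Sum>k\<in>?K. c0 J k *\<^sub>R w k)"
        by (auto dest!: choice)
      \<comment> \<open>Makes the coefficients sum to 0 by construction; they still represent the
        form of \<open>J0\<close> because all the forms sum to 0.\<close>
      define c where "c J k = (if J = J0 then - (\<Sum>J\<in>\<I> - {J0}. c0 J k) else c0 J k)" for J k
      have sum_c: "(\<Sum>J\<in>\<I>. c J k) = 0" for k
        by (simp add: sum.remove[OF finI J0] c_def)
      have c: "(g J, b J) = (\<Sum>k\<in>?K. c J k *\<^sub>R w k)" if "J \<in> \<I>" for J
      proof (cases "J = J0")
        case True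
        have "(g J0, b J0) + (\<Sum>J\<in>\<I> - {J0}. (g J, b J)) = (\<Sum>J\<in>\<I>. (g J, b J))"
          by (simp add: sum.remove[OF finI J0])
        also have "\<dots> = 0"
          using g(1,2) by (simp add: sum_prod zero_prod_def)
        finally have "(g J0, b J0) = - (\<Sum>J\<in>\<I> - {J0}. \<Sum>k\<in>?K. c0 J k *\<^sub>R w k)"
          using c0 by (simp add: eq_neg_iff_add_eq_0)
        also have "\<dots> = (\<Sum>k\<in>?K. c J0 k *\<^sub>R w k)"
          by (subst sum.swap) (simp add: c_def scaleR_sum_left sum_negf)
        finally show ?thesis
          using True by simp
      qed (use c0 in \<open>simp add: c_def\<close>)
      have "0 < (\<Sum>k\<in>?K. c J k * (w k \<bullet> (q i, 1)))" if "J \<in> \<I>" "i \<in> J" for J i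
      proof -
        have "0 < g J \<bullet> q i + b J"
          using that by (intro g(3)) (auto intro: hull_inc)
        also have "\<dots> = (g J, b J) \<bullet> (q i, 1)"
          by simp
        also have "\<dots> = (\<Sum>k\<in>?K. c J k * (w k \<bullet> (q i, 1)))"
          unfolding c[OF that(1)] by (simp only: inner_sum_left inner_scaleR_left)
        finally show ?thesis .
      qed
      then show False
        using no_separating_functionals[OF type r col str C(2), of c] sum_c by blast
    qed
  qed
qed

section \<open>Perturbation into general position\<close>

text \<open>Points are chosen one after the other. A new lifted point must avoid the spans of at
  most \<open>CARD('d)\<close> earlier ones; these cut out finitely many negligible sets, which
  cannot cover a nonempty open set.\<close>

lemma general_position_lift_exists:
  fixes X :: "nat \<Rightarrow> (real ^ 'd::finite) set"
  assumes X: "\<And>i. open (X i)" "\<And>i. X i \<noteq> {}"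
  obtains q where "\<And>i. q i \<in> X i" "general_position (\<lambda>i. (q i, 1 :: real)) {1..n}"
proof -
  have "\<exists>q. (\<forall>i. q i \<in> X i) \<and>
      (\<forall>Y\<subseteq>{1..n}. card Y \<le> CARD('d) + 1 \<longrightarrow> dim ((\<lambda>i. (q i, 1 :: real)) ` Y) = card Y)"
  proof (induction n)
    case 0
    show ?case
      using X(2) by (intro exI[of _ "\<lambda>i. SOME x. x \<in> X i"]) (auto simp: some_in_eq)
  next
    case (Suc n)
    then obtain q where q: "\<And>i. q i \<in> X i"
        "\<And>Y. Y \<subseteq> {1..n} \<Longrightarrow> card Y \<le> CARD('d) + 1 \<Longrightarrow> dim ((\<lambda>i. (q i, 1 :: real)) ` Y) = card Y"
      by blast
    let ?bad = "\<lambda>Y. {x. (x, 1 :: real) \<in> span ((\<lambda>i. (q i, 1 :: real)) ` Y)}"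
    have "negligible (?bad Y)" if Y: "Y \<subseteq> {1..n}" "card Y \<le> CARD('d)" for Y
    proof -
      have "dim ((\<lambda>i. (q i, 1 :: real)) ` Y) < DIM((real ^ 'd) \<times> real)"
        using q(2)[OF Y(1)] Y(2) by simp
      then obtain w where w: "w \<noteq> 0" "\<And>y. y \<in> span ((\<lambda>i. (q i, 1 :: real)) ` Y) \<Longrightarrow> orthogonal w y"
        using orthogonal_to_subspace_exists by blast
      obtain a b where ab: "w = (a, b)"
        by (cases w)
      have "?bad Y \<subseteq> {x. a \<bullet> x = - b}"
      proof clarify
        fix x :: "real ^ 'd" assume "(x, 1 :: real) \<in> span ((\<lambda>i. (q i, 1 :: real)) ` Y)"
        then have "orthogonal w (x, 1)"
          by (rule w(2))
        then show "a \<bullet> x = - b"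
          by (simp add: ab orthogonal_def eq_neg_iff_add_eq_0)
      qed
      \<comment> \<open>If \<open>a = 0\<close> then \<open>b \<noteq> 0\<close>, and the set is
        empty.\<close>
      moreover have "negligible {x. a \<bullet> x = - b}"
        using w(1) by (cases "a = 0") (auto simp: ab zero_prod_def intro: negligible_hyperplane)
      ultimately show ?thesis
        using negligible_subset by blast
    qed
    define B where "B = (\<Union>Y\<in>{Y. Y \<subseteq> {1..n} \<and> card Y \<le> CARD('d)}. ?bad Y)"
    have "negligible B"
      unfolding B_def using \<open>\<And>Y. \<lbrakk>Y \<subseteq> {1..n}; card Y \<le> CARD('d)\<rbrakk> \<Longrightarrow> negligible (?bad Y)\<close>
      by (intro negligible_Union) auto
    moreover have "\<not> negligible (X (Suc n))"
      by (rule open_not_negligible[OF X])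
    ultimately have "\<not> X (Suc n) \<subseteq> B"
      by (blast dest: negligible_subset)
    then obtain x where "x \<in> X (Suc n)" "x \<notin> B"
      by blast
    then have x: "x \<in> X (Suc n)"
        "\<And>Y. Y \<subseteq> {1..n} \<Longrightarrow> card Y \<le> CARD('d) \<Longrightarrow> (x, 1) \<notin> span ((\<lambda>i. (q i, 1 :: real)) ` Y)"
      unfolding B_def by simp_all
    define q' where "q' = q(Suc n := x)"
    have "dim ((\<lambda>i. (q' i, 1 :: real)) ` Y) = card Y"
      if Y: "Y \<subseteq> {1..Suc n}" "card Y \<le> CARD('d) + 1" for Y
    proof -
      have q'_eq: "(\<lambda>i. (q' i, 1 :: real)) ` Z = (\<lambda>i. (q i, 1)) ` Z" if "Z \<subseteq> {1..n}" for Z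
        using that by (intro image_cong) (auto simp: q'_def)
      show ?thesis
      proof (cases "Suc n \<in> Y")
        case False
        then have "Y \<subseteq> {1..n}"
          using Y(1) by (auto simp: le_Suc_eq)
        then show ?thesis
          using q(2) Y(2) q'_eq by simp
      next
        case True
        define Z where "Z = Y - {Suc n}"
        have Z: "Z \<subseteq> {1..n}" "Y = insert (Suc n) Z" "Suc n \<notin> Z"
          using Y(1) True by (auto simp: Z_def le_Suc_eq)
        have finZ: "finite Z"
          using Z(1) finite_subset by blast
        then have cardY: "card Y = Suc (card Z)"
          using Z by simp
        have "(\<lambda>i. (q' i, 1 :: real)) ` Y = insert (x, 1) ((\<lambda>i. (q i, 1)) ` Z)"
          using q'_eq[OF Z(1)] Z(2) by (simp add: q'_def)
        then show ?thesis
          using x(2)[OF Z(1)] q(2)[OF Z(1)] cardY Y(2) by (simp add: dim_insert)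
      qed
    qed
    moreover have "\<forall>i. q' i \<in> X i"
      using q(1) x(1) by (simp add: q'_def)
    ultimately show ?case
      by blast
  qed
  then obtain q where q: "\<And>i. q i \<in> X i"
      "\<And>Y. Y \<subseteq> {1..n} \<Longrightarrow> card Y \<le> CARD('d) + 1 \<Longrightarrow> dim ((\<lambda>i. (q i, 1 :: real)) ` Y) = card Y"
    by blast
  have "general_position (\<lambda>i. (q i, 1 :: real)) {1..n}"
    unfolding general_position_def
  proof (intro allI impI, elim conjE)
    fix Y and w :: "(real ^ 'd) \<times> real"
    assume Y: "Y \<subseteq> {1..n}" "card Y = DIM((real ^ 'd) \<times> real)" and w: "\<forall>i\<in>Y. w \<bullet> (q i, 1) = 0"
    have "dim ((\<lambda>i. (q i, 1 :: real)) ` Y) = DIM((real ^ 'd) \<times> real)"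
      using q(2)[OF Y(1)] Y(2) by simp
    then have "w \<in> span ((\<lambda>i. (q i, 1 :: real)) ` Y)"
      by (simp only: dim_eq_full UNIV_I)
    then have "orthogonal w w"
      by (rule orthogonal_to_span) (use w in \<open>auto simp: orthogonal_def\<close>)
    then show "w = 0"
      by (simp add: orthogonal_self)
  qed
  with q(1) show thesis
    using that by blast
qed

lemma finite_polys: "finite (polys F)"
  by (induction F) auto

lemma holds_cong:
  "(\<And>f. f \<in> polys F \<Longrightarrow> poly_value f p > 0 \<longleftrightarrow> poly_value f q > 0) \<Longrightarrow> holds F p \<longleftrightarrow> holds F q"
  by (induction F) auto

lemma poly_value_cong:
  assumes "poly_vars f \<subseteq> A \<times> UNIV" "\<And>i. i \<in> A \<Longrightarrow> p i = q i"
  shows "poly_value f p = poly_value f q"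
proof -
  have "p (fst x) = q (fst x)" if "m \<in> Poly_Mapping.keys f" "x \<in> Poly_Mapping.keys m" for m x
  proof -
    have "x \<in> poly_vars f"
      using that unfolding poly_vars_def by blast
    then have "fst x \<in> A"
      using subsetD[OF assms(1), of x] by (simp add: mem_Times_iff)
    then show ?thesis
      by (rule assms(2))
  qed
  then show ?thesis
    unfolding poly_value_def by (intro sum.cong arg_cong2[of _ _ _ _ "(*)"] prod.cong arg_cong2[of _ _ _ _ "(^)"] refl) simp
qed

text \<open>Only finitely many polynomials and index tuples matter, so a small perturbation of a
  generic \<open>p\<close> preserves all signs. An occurrence in a nearby sequence in general
  position is therefore one in \<open>p\<close>.\<close>

lemma unavoidable_if_general_position:
  fixes \<Phi> :: "(nat \<Rightarrow> real ^ 'd::finite) \<Rightarrow> bool"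
  assumes "semialgebraic k \<Phi>"
    and N: "\<And>n q. N \<le> n \<Longrightarrow> general_position (\<lambda>i. (q i, 1 :: real)) {1..n} \<Longrightarrow> occurs k \<Phi> n q"
  shows "unavoidable k \<Phi>"
  unfolding unavoidable_def
proof (intro conjI allI impI exI[of _ N])
  fix F n and p :: "nat \<Rightarrow> real ^ 'd"
  assume F: "describes k F \<Phi>" and n: "N \<le> n" and gen: "generic k F n p"
  \<comment> \<open>Extensional functions, so that there are only finitely many index
    tuples.\<close>
  define M :: "(nat \<Rightarrow> nat) set" where "M = {i \<in> {1..k} \<rightarrow>\<^sub>E {1..n}. inj_on i {1..k}}"
  have finM: "finite M"
    unfolding M_def by (simp add: finite_PiE)
  define U where "U = {q. \<forall>i\<in>M. \<forall>f\<in>polys F. 0 < poly_value f (q \<circ> i) * poly_value f (p \<circ> i)}"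
  have "open U"
  proof -
    have cont: "continuous_on UNIV (\<lambda>q. poly_value f (q \<circ> i) * poly_value f (p \<circ> i))"
      for f :: "'d point_poly" and i :: "nat \<Rightarrow> nat"
    proof -
      have "continuous_on UNIV (\<lambda>q :: nat \<Rightarrow> real ^ 'd. q \<circ> i)"
        unfolding comp_def
        by (intro continuous_on_coordinatewise_then_product continuous_on_product_coordinates)
      then have "continuous_on UNIV (\<lambda>q. poly_value f (q \<circ> i))"
        by (rule continuous_on_compose2[OF continuous_on_poly_value _ subset_UNIV])
      then show ?thesis
        by (rule continuous_on_mult_right)
    qed
    have "U = (\<Inter>i\<in>M. \<Inter>f\<in>polys F. {q. 0 < poly_value f (q \<circ> i) * poly_value f (p \<circ> i)})"
      by (auto simp: U_def)
    also have "open \<dots>"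
      using finM finite_polys cont by (intro open_INT ballI open_Collect_less continuous_on_const) auto
    finally show ?thesis .
  qed
  moreover have "p \<in> U"
    using gen by (auto simp: U_def M_def generic_def zero_less_mult_iff linorder_neq_iff)
  ultimately obtain X where X: "p \<in> PiE UNIV X" "\<And>i. open (X i)" "PiE UNIV X \<subseteq> U"
    using product_topology_open_contains_basis[of "\<lambda>i. euclidean" UNIV U p]
    by (auto simp: open_fun_def)
  obtain q where q: "\<And>i. q i \<in> X i" "general_position (\<lambda>i. (q i, 1 :: real)) {1..n}"
    using general_position_lift_exists[of X n] X(1,2) by blast
  have "q \<in> U"
    using X(3) q(1) by auto
  obtain i where i: "strict_mono_on {1..k} i" "i ` {1..k} \<subseteq> {1..n}" "\<Phi> (q \<circ> i)"
    using N[OF n q(2)] unfolding occurs_def by blast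
  \<comment> \<open>\<open>i\<close> is arbitrary outside \<open>{1..k}\<close>; its restriction
    lies in \<open>M\<close> and gives the same polynomial values.\<close>
  define i' where "i' = restrict i {1..k}"
  have i': "i' \<in> M"
  proof -
    have "inj_on i' {1..k} \<longleftrightarrow> inj_on i {1..k}"
      by (intro inj_on_cong) (simp add: i'_def)
    moreover have "i' \<in> {1..k} \<rightarrow>\<^sub>E {1..n}"
      using i(2) by (simp add: i'_def image_subset_iff)
    ultimately show ?thesis
      using strict_mono_on_imp_inj_on[OF i(1)] by (simp add: M_def)
  qed
  have sign: "0 < poly_value f (q \<circ> i) * poly_value f (p \<circ> i)" if f: "f \<in> polys F" for f
  proof -
    have "poly_vars f \<subseteq> {1..k} \<times> UNIV"
      using F f unfolding describes_def by blast
    then have "poly_value f (y \<circ> i) = poly_value f (y \<circ> i')" for y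
      by (rule poly_value_cong) (simp add: i'_def)
    then show ?thesis
      using \<open>q \<in> U\<close> i' f by (simp add: U_def)
  qed
  have "\<Phi> (y \<circ> i) \<longleftrightarrow> holds F (y \<circ> i)" if "y \<in> {p, q}" for y
  proof -
    have "\<forall>f\<in>polys F. poly_value f (y \<circ> i) \<noteq> 0"
    proof
      fix f assume "f \<in> polys F"
      from sign[OF this] show "poly_value f (y \<circ> i) \<noteq> 0"
        using that by auto
    qed
    then show ?thesis
      using F unfolding describes_def by blast
  qed
  moreover have "holds F (p \<circ> i) \<longleftrightarrow> holds F (q \<circ> i)"
  proof (rule holds_cong)
    fix f assume "f \<in> polys F"
    from sign[OF this] show "0 < poly_value f (p \<circ> i) \<longleftrightarrow> 0 < poly_value f (q \<circ> i)"
      by (auto simp: zero_less_mult_iff)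
  qed
  ultimately show "occurs k \<Phi> n p"
    using i unfolding occurs_def by blast
qed (rule assms(1))

section \<open>The dichotomy\<close>

theorem unavoidability_dichotomy_general:
  fixes \<I> :: "nat set set"
  assumes type: "tverberg_type CARD('d::finite) r \<I>" and r: "1 \<le> r"
  shows "unavoidability_dichotomy TYPE('d) r \<I>"
proof -
  let ?T = "tverberg_number CARD('d) r"
  \<comment> \<open>Meets the thresholds of both directions of
    \<open>Tv_iff_colorful\<close>.\<close>
  define C :: real where "C = max ((real ?T)\<^sup>2 + 1) (16 * (real r)\<^sup>2)"
  have C: "(real ?T)\<^sup>2 < C" "16 * (real r)\<^sup>2 \<le> C" "1 \<le> C"
    by (auto simp: C_def le_max_iff_disj)
  have T: "1 \<le> ?T"
    by (simp add: tverberg_number_def)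
  obtain N where N: "\<forall>(v :: nat \<Rightarrow> (real ^ 'd) \<times> real) S. general_position v S \<and> finite S \<and> N \<le> card S \<longrightarrow>
      (\<exists>i w. strict_mono_on {1..?T} i \<and> i ` {1..?T} \<subseteq> S \<and>
        stretched C DIM((real ^ 'd) \<times> real) ?T (\<lambda>k l. w k \<bullet> v (i l)) \<and>
        (\<forall>g. \<exists>c. g = (\<Sum>k\<in>{1..DIM((real ^ 'd) \<times> real)}. c k *\<^sub>R w k)))"
    using stretched_subsequence[OF T C(3), where 'a = "(real ^ 'd) \<times> real"] by (elim exE)
  \<comment> \<open>One subsequence serves both cases, since on it the predicate agrees with
    colorfulness of the type.\<close>
  have occ: "\<exists>i. strict_mono_on {1..?T} i \<and> i ` {1..?T} \<subseteq> {1..n} \<and>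
      (Tv \<I> (q \<circ> i) \<longleftrightarrow> colorful CARD('d) r \<I>)"
    if "N \<le> n" "general_position (\<lambda>i. (q i, 1 :: real)) {1..n}" for n and q :: "nat \<Rightarrow> real ^ 'd"
  proof -
    have "general_position (\<lambda>i. (q i, 1 :: real)) {1..n} \<and> finite {1..n} \<and> N \<le> card {1..n}"
      using that by simp
    from N[THEN spec, THEN spec, THEN mp, OF this] show ?thesis
    proof (elim exE conjE)
      fix i and w :: "nat \<Rightarrow> (real ^ 'd) \<times> real"
      assume i: "strict_mono_on {1..?T} i" "i ` {1..?T} \<subseteq> {1..n}"
        and w: "stretched C DIM((real ^ 'd) \<times> real) ?T (\<lambda>k l. w k \<bullet> (q (i l), 1))"
          "\<forall>g. \<exists>c. g = (\<Sum>k\<in>{1..DIM((real ^ 'd) \<times> real)}. c k *\<^sub>R w k)"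
      have dim: "DIM((real ^ 'd) \<times> real) = CARD('d) + 1"
        by simp
      have "Tv \<I> (q \<circ> i) \<longleftrightarrow> colorful CARD('d) r \<I>"
      proof (rule Tv_iff_colorful[where w = w, OF type r _ C(1,2)])
        show "stretched C (CARD('d) + 1) ?T (\<lambda>k l. w k \<bullet> ((q \<circ> i) l, 1))"
          using w(1) unfolding dim comp_def .
        show "\<exists>c. g = (\<Sum>k\<in>{1..CARD('d) + 1}. c k *\<^sub>R w k)" for g
          using w(2) unfolding dim by (rule spec)
      qed
      with i show ?thesis
        by blast
    qed
  qed
  have semi: "semialgebraic ?T (\<lambda>p :: nat \<Rightarrow> real ^ 'd. Tv \<I> p)"
    using type unfolding tverberg_type_def by (intro semialgebraic_Tv) blast
  show ?thesis
    unfolding unavoidability_dichotomy_def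
  proof (intro conjI impI)
    assume "colorful CARD('d) r \<I>"
    then show "unavoidable ?T (\<lambda>p :: nat \<Rightarrow> real ^ 'd. Tv \<I> p)"
      using occ by (intro unavoidable_if_general_position[OF semi]) (auto simp: occurs_def)
  next
    assume "\<not> colorful CARD('d) r \<I>"
    then show "unavoidable ?T (\<lambda>p :: nat \<Rightarrow> real ^ 'd. \<not> Tv \<I> p)"
      using occ by (intro unavoidable_if_general_position[OF semialgebraic_not[OF semi]])
        (auto simp: occurs_def)
  qed
qed

section \<open>Types encoded by strings\<close>

lemma tverberg_type_encoded:
  assumes range: "\<And>i. i \<in> {1..tverberg_number d r} \<Longrightarrow> \<sigma> i \<in> {1..r}"
    and onto: "\<And>j. j \<in> {1..r} \<Longrightarrow> \<exists>i\<in>{1..tverberg_number d r}. \<sigma> i = j"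
  shows "tverberg_type d r (encoded_type d r \<sigma>)"
proof -
  let ?part = "\<lambda>j. {i \<in> {1..tverberg_number d r}. \<sigma> i = j}"
  have "inj_on ?part {1..r}"
    using onto by (intro inj_onI) blast
  then have "card (encoded_type d r \<sigma>) = r"
    unfolding encoded_type_def by (simp add: card_image)
  moreover have "partition_on {1..tverberg_number d r} (encoded_type d r \<sigma>)"
    unfolding partition_on_def
  proof (intro conjI)
    show "\<Union> (encoded_type d r \<sigma>) = {1..tverberg_number d r}"
    proof (intro equalityI subsetI)
      fix i assume i: "i \<in> {1..tverberg_number d r}"
      then have "i \<in> ?part (\<sigma> i)"
        by simp
      with range[OF i] show "i \<in> \<Union> (encoded_type d r \<sigma>)"
        unfolding encoded_type_def by (rule UN_I)
    qed (auto simp: encoded_type_def)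
    show "disjoint (encoded_type d r \<sigma>)"
      by (auto simp: disjoint_def encoded_type_def)
    show "{} \<notin> encoded_type d r \<sigma>"
    proof
      assume "{} \<in> encoded_type d r \<sigma>"
      then obtain j where "j \<in> {1..r}" "?part j = {}"
        unfolding encoded_type_def by (metis (no_types, lifting) imageE)
      with onto[of j] show False
        by blast
    qed
  qed
  ultimately show ?thesis
    by (simp add: tverberg_type_def)
qed

lemma tverberg_type_zigzag:
  assumes r: "1 \<le> r"
  shows "tverberg_type d r (zigzag_type d r)"
  unfolding zigzag_type_def
proof (rule tverberg_type_encoded)
  fix i assume i: "i \<in> {1..tverberg_number d r}"
  show "zigzag_string r i \<in> {1..r}"
  \<comment> \<open>For \<open>r = 1\<close> the period is 0 and \<open>mod\<close> by 0 is the
    identity; only \<open>i = 1\<close> occurs, with value 1.\<close>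
  proof (cases "r = 1")
    case True
    then show ?thesis
      using i by (simp add: zigzag_string_def tverberg_number_def)
  next
    case False
    then have "(i - 1) mod (2 * (r - 1)) < 2 * (r - 1)"
      using r by (intro mod_less_divisor) simp
    then show ?thesis
      by (auto simp: zigzag_string_def Let_def)
  qed
next
  fix j assume j: "j \<in> {1..r}"
  then have "j \<le> tverberg_number d r"
    by (auto simp: tverberg_number_def)
  \<comment> \<open>The first \<open>r\<close> letters of the walk already meet every part.\<close>
  moreover have "(j - 1) mod (2 * (r - 1)) = j - 1"
    using j by (cases "r = 1") auto
  then have "zigzag_string r j = j"
    using j by (auto simp: zigzag_string_def Let_def)
  ultimately show "\<exists>i\<in>{1..tverberg_number d r}. zigzag_string r i = j"
    using j by (intro bexI[of _ j]) auto
qed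

theorem theorem1p4:
  shows
    "(CARD('d::finite) \<le> 2 \<longrightarrow>
        (\<forall>r \<ge> 1. \<forall>\<I>. tverberg_type CARD('d) r \<I> \<longrightarrow> unavoidability_dichotomy TYPE('d) r \<I>)) \<and>
     (CARD('d) = 3 \<longrightarrow>
        (\<forall>r \<ge> 1. \<forall>\<I>. tverberg_type CARD('d) r \<I> \<and>
           image_mset card (mset_set \<I>) = {#2, 3#} + replicate_mset (r - 2) 4 \<longrightarrow>
           unavoidability_dichotomy TYPE('d) r \<I>)) \<and>
     (CARD('d) = 3 \<longrightarrow>
        (\<forall>\<I>. tverberg_type CARD('d) 3 \<I> \<and> colorful CARD('d) 3 \<I> \<and> (\<forall>J \<in> \<I>. card J = 3) \<longrightarrow>
           unavoidability_dichotomy TYPE('d) 3 \<I>)) \<and>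
     (CARD('d) = 4 \<longrightarrow>
        (\<forall>r \<ge> 1. unavoidability_dichotomy TYPE('d) r (zigzag_type CARD('d) r)))"
  by (intro conjI allI impI; (elim conjE)?;
      rule unavoidability_dichotomy_general; simp add: tverberg_type_zigzag)

end
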